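(* Let $k_1,k_2$ be positive integers, $k=k_1+k_2$, and $\ell\in\mathbb{N}$. Let $E_{p,q}$ denote the $k\times k$ matrix units. Let $R_{[k_1,k_2],\ell+1}=(R_{[k_1,k_2],\ell+1})_0+(R_{[k_1,k_2],\ell+1})_1$ be the conformal superalgebra (with $\partial$, $Y^+(\cdot,z)$ as in the context) with even and odd parts $$(R_{[k_1,k_2],\ell+1})_0=\mathrm{span}\{(E_{p_1,q_1})_{[0,0]}(m,\ell+n),\ (E_{k_1+p_2,k_1+q_2})_{[1,1]}(m,\ell+n)\mid 1\le p_1,q_1\le k_1,\ 1\le p_2,q_2\le k_2,\ m,n\in\mathbb{N}\},$$ $$(R_{[k_1,k_2],\ell+1})_1=\mathrm{span}\{(E_{p_1,k_1+p_2})_{[0,1]}(m,\ell+n),\ (E_{k_1+p_2,p_1})_{[1,0]}(m,\ell+n)\mid 1\le p_1\le k_1,\ 1\le p_2\le k_2,\ m,n\in\mathbb{N}\}.$$ Then the conformal superalgebra $R_{[k_1,k_2],\ell+1}$ is simple. When $k>2$, it is generated by its subspace of weight $\ell+3/2$, $$R_{[k_1,k_2],\ell+1}^{(\ell+3/2)}=\mathrm{span}\{(E_{p_1,k_1+p_2})_{[0,1]}(0,\ell),\ (E_{k_1+p_2,p_1})_{[1,0]}(0,\ell)\mid 1\le p_1\le k_1,\ 1\le p_2\le k_2\}.$$ If $k=2$, it is generated by the set $$\{(E_{1,2})_{[0,1]}(0,\ell),\ (E_{2,1})_{[1,0]}(0,\ell),\ (E_{2,2})_{[1,1]}(0,\e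ll+1)\}.$$
   Context: Conventions. $\mathbb{F}$ is an arbitrary field of characteristic $0$; $\mathbb{N}=\{0,1,2,\dots\}$; $\binom{a}{n}=a(a-1)\cdots(a-n+1)/n!$ for $a\in\mathbb{Z}$, $n\in\mathbb{N}$; elements of $\mathbb{Z}_2$ are written $0,1$. $\mathrm{Res}_x$ takes the coefficient of $x^{-1}$. All binomials such as $(z-x)^{-1}$ are expanded in nonnegative powers of the second variable. $LM(V_1,V_2)$ is the space of linear maps $V_1\to V_2$. Conformal superalgebra. A conformal superalgebra $(R,\partial,Y^+(\cdot,z))$ is a $\mathbb{Z}_2$-graded $\mathbb{F}[\partial]$-module $R=R_0\oplus R_1$ with a $\mathbb{Z}_2$-graded linear map $Y^+(\cdot,z):R\to LM(R,R[z^{-1}]z^{-1})$ such that, for $u\in R_i$, $v\in R_j$: $Y^+(\partial u,z)=\frac{d}{dz}Y^+(u,z)$; $Y^+(u,z)v=(-1)^{ij}\mathrm{Res}_x\frac{e^{x\partial}Y^+(v,-x)u}{z-x}$; $Y^+(u,z_1)Y^+(v,z_2)-(-1)^{ij}Y^+(v,z_2)Y^+(u,z_1)=\mathrm{Res}_x\frac{Y^+(Y^+(u,z_1-x)v,x)}{z_2-x}$. Write $Y^+(u,z)=\sum_{n\ge 0}u_nz^{-n-1}$. An ideal is a subspace $\mathcal{I}\subset R$ with $\partial(\mathcal{I})\subset\mathcal{I}$ and $Y^+(u,z)\mathcal{I}\subset\mathcal{I}[z^{-1}]$ for all $u\in R$. $R$ is simple if its only ideals are $\{0\}$ and $R$.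 A (sub-)superalgebra $R'$ is generated by a subset $S$ if $R'=\mathrm{span}\{u^1_{m_1}\cdots u^p_{m_p}v\mid u^1,\dots,u^p,v\in S,\ p,m_1,\dots,m_p\in\mathbb{N}\}$ (for $p=0$ the expression is $v$). Construction. Let $\mathcal{A}=M_{k\times k}(\mathbb{F})$, $k=k_1+k_2$, with the $\mathbb{Z}_2$-grading $\mathcal{A}=\mathcal{A}_0\oplus\mathcal{A}_1$ in which $\mathcal{A}_0$ consists of the block-diagonal matrices (diagonal blocks of sizes $k_1\times k_1$ and $k_2\times k_2$) and $\mathcal{A}_1$ of the block-off-diagonal ones. Let $R(\mathcal{A})=\bigoplus_{i,j\in\mathbb{Z}_2}\mathcal{A}_{i+j}\otimes\mathbb{F}[t_1,t_2]$, and denote by $u_{[i,j]}(m,n)$ the element $u\otimes t_1^mt_2^n$ of the $(i,j)$-summand ($u\in\mathcal{A}_{i+j}$, $m,n\in\mathbb{N}$); it has parity $i+j$. Define $$\partial u_{[i,j]}(m,n)=(m+1)u_{[i,j]}(m+1,n)+(n+1)u_{[i,j]}(m,n+1),$$ $$Y^+(u_{[i_1,i_2]}(m_1,m_2),z)v_{[j_1,j_2]}(n_1,n_2)=\delta_{i_2,j_1}(n_1\delta_{i_2,0}+1)\binom{-n_1-1-\delta_{i_2,0}}{m_2}\sum_{p=0}^{m_1+m_2+n_1+\delta_{i_2,0}}\binom{p}{m_1}(uv)_{[i_1,j_2]}(p,n_2)z^{p-m_1-m_2-n_1-1-\delta_{i_2,0}}$$ $$-(-1)^{(i_1+i_2)(j_1+j_2)}\delta_{i_1,j_2}\bigl(\delta_{i_1,1}-(n_2+1)\delta_{i_1,0}\bigr)\binom{-n_2-1-\delta_{i_1,0}}{m_1}\sum_{q=0}^{m_1+m_2+n_2+\delta_{i_1,0}}\binom{q}{m_2}(vu)_{[j_1,i_2]}(n_1,q)z^{q-m_1-m_2-n_2-1-\delta_{i_1,0}}.$$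 Then $(R(\mathcal{A}),\partial,Y^+(\cdot,z))$ is a conformal superalgebra, and the subspace $R_{[k_1,k_2],\ell+1}$ of the claim is closed under $\partial$ and $Y^+$, hence a conformal superalgebra with the restricted structure. The weight of $u_{[i,j]}(m,n)$ is $m+n+\delta_{i,0}+\delta_{j,0}+(\delta_{i,1}+\delta_{j,1})/2$; a superscript $(w)$ denotes the subspace of elements of weight $w$. *)

theory Defs
  imports "HOL-Analysis.Analysis" "HOL-Library.Poly_Mapping" "HOL-Library.Z2"
begin

section \<open>Conformal superalgebras\<close>

definition koszul_sign :: "bit \<Rightarrow> bit \<Rightarrow> 'a::ring_1" where
  "koszul_sign i j = (if i = 1 \<and> j = 1 then - 1 else 1)"

definition whole :: "(bit \<Rightarrow> 'v::ab_group_add set) \<Rightarrow> 'v set" where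
  "whole R = {a + b | a b. a \<in> R 0 \<and> b \<in> R 1}"

text \<open>
  \<open>Y u v\<close> is the Laurent polynomial \<open>Y\<^sup>+(u,z)v\<close>: its coefficient of \<open>z\<^sup>e\<close> is
  \<open>Poly_Mapping.lookup (Y u v) e\<close>.  The modes are given by \<open>Y\<^sup>+(u,z)v = \<Sum>\<^sub>n (u\<^sub>n v) z\<^bsup>-n-1\<^esup>\<close>.
\<close>

definition mode :: "('v \<Rightarrow> 'v \<Rightarrow> (int \<Rightarrow>\<^sub>0 'v)) \<Rightarrow> nat \<Rightarrow> 'v \<Rightarrow> 'v \<Rightarrow> 'v::ab_group_add" where
  "mode Y n u v = Poly_Mapping.lookup (Y u v) (- int n - 1)"

text \<open>
  The two residue axioms are stated coefficientwise.

  Skew-symmetry, coefficient of \<open>z\<^bsup>-n-1\<^esup>\<close>.  Here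
  \<open>Y\<^sup>+(v,-x)u = \<Sum>\<^sub>r (-1)\<^bsup>r+1\<^esup> (v\<^sub>r u) x\<^bsup>-r-1\<^esup>\<close>, \<open>e\<^bsup>x\<partial>\<^esup> = \<Sum>\<^sub>k x\<^sup>k \<partial>\<^sup>k / k!\<close> and
  \<open>(z - x)\<^bsup>-1\<^esup> = \<Sum>\<^sub>n x\<^sup>n z\<^bsup>-n-1\<^esup>\<close>, so the residue selects \<open>r = n + k\<close>.

  Commutator formula, coefficient of \<open>z\<^sub>1\<^bsup>-m-1\<^esup> z\<^sub>2\<^bsup>-n-1\<^esup>\<close>.  Here
  \<open>Y\<^sup>+(Y\<^sup>+(u,z\<^sub>1-x)v,x) = \<Sum>\<^sub>r \<Sum>\<^sub>s \<Sum>\<^sub>j binom(-r-1,j) (-1)\<^sup>j z\<^sub>1\<^bsup>-r-1-j\<^esup> (u\<^sub>r v)\<^sub>s x\<^bsup>j-s-1\<^esup>\<close>; the residue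
  selects \<open>s = n + j\<close>, the power of \<open>z\<^sub>1\<close> forces \<open>j = m - r\<close>, and
  \<open>binom(-r-1,m-r) (-1)\<^bsup>m-r\<^esup> = binom(m,r)\<close>.
\<close>

locale conformal_superalgebra = vector_space scale
  for scale :: "'a::field_char_0 \<Rightarrow> 'v::ab_group_add \<Rightarrow> 'v" +
  fixes R :: "bit \<Rightarrow> 'v set"
    and D :: "'v \<Rightarrow> 'v"
    and Y :: "'v \<Rightarrow> 'v \<Rightarrow> (int \<Rightarrow>\<^sub>0 'v)"
  assumes subspace_R: "subspace (R i)"
    and direct: "R 0 \<inter> R 1 = {0}"
    and D_closed: "u \<in> R i \<Longrightarrow> D u \<in> R i"
    and D_add: "\<lbrakk>u \<in> whole R; v \<in> whole R\<rbrakk> \<Longrightarrow> D (u + v) = D u + D v"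
    and D_scale: "u \<in> whole R \<Longrightarrow> D (scale c u) = scale c (D u)"
    and Y_keys: "\<lbrakk>u \<in> whole R; v \<in> whole R\<rbrakk> \<Longrightarrow> Poly_Mapping.keys (Y u v) \<subseteq> {..<0}"
    and Y_closed: "\<lbrakk>u \<in> R i; v \<in> R j\<rbrakk> \<Longrightarrow> Poly_Mapping.lookup (Y u v) e \<in> R (i + j)"
    and Y_add_left: "\<lbrakk>u \<in> whole R; v \<in> whole R; w \<in> whole R\<rbrakk> \<Longrightarrow> Y (u + v) w = Y u w + Y v w"
    and Y_add_right: "\<lbrakk>u \<in> whole R; v \<in> whole R; w \<in> whole R\<rbrakk> \<Longrightarrow> Y u (v + w) = Y u v + Y u w"
    and Y_scale_left: "\<lbrakk>u \<in> whole R; v \<in> whole R\<rbrakk> \<Longrightarrow>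
          Poly_Mapping.lookup (Y (scale c u) v) e = scale c (Poly_Mapping.lookup (Y u v) e)"
    and Y_scale_right: "\<lbrakk>u \<in> whole R; v \<in> whole R\<rbrakk> \<Longrightarrow>
          Poly_Mapping.lookup (Y u (scale c v)) e = scale c (Poly_Mapping.lookup (Y u v) e)"
    and Y_deriv: "\<lbrakk>u \<in> R i; v \<in> R j\<rbrakk> \<Longrightarrow>
          Poly_Mapping.lookup (Y (D u) v) e
            = scale (of_int (e + 1)) (Poly_Mapping.lookup (Y u v) (e + 1))"
    and skew_symmetry: "\<lbrakk>u \<in> R i; v \<in> R j\<rbrakk> \<Longrightarrow>
          mode Y n u v = scale (koszul_sign i j)
            (\<Sum>k | mode Y (n + k) v u \<noteq> 0.
               scale ((- 1) ^ (n + k + 1) / fact k) ((D ^^ k) (mode Y (n + k) v u)))"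
    and commutator: "\<lbrakk>u \<in> R i; v \<in> R j; w \<in> whole R\<rbrakk> \<Longrightarrow>
          mode Y m u (mode Y n v w) - scale (koszul_sign i j) (mode Y n v (mode Y m u w))
            = (\<Sum>r\<le>m. scale (of_nat (m choose r)) (mode Y (m + n - r) (mode Y r u v) w))"
begin

definition ideal :: "'v set \<Rightarrow> bool" where
  "ideal I \<longleftrightarrow> subspace I \<and> I \<subseteq> whole R \<and> D ` I \<subseteq> I \<and>
     (\<forall>u\<in>whole R. \<forall>v\<in>I. \<forall>e. Poly_Mapping.lookup (Y u v) e \<in> I)"

definition simple :: bool where
  "simple \<longleftrightarrow> (\<forall>I. ideal I \<longrightarrow> I = {0} \<or> I = whole R)"

inductive_set monomials :: "'v set \<Rightarrow> 'v set" for S :: "'v set" where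
  gen: "v \<in> S \<Longrightarrow> v \<in> monomials S"
| app: "\<lbrakk>u \<in> S; w \<in> monomials S\<rbrakk> \<Longrightarrow> mode Y m u w \<in> monomials S"

text \<open>No derivatives \<open>D\<close> of generators are adjoined.\<close>

definition generated_by :: "'v set \<Rightarrow> bool" where
  "generated_by S \<longleftrightarrow> S \<subseteq> whole R \<and> whole R = span (monomials S)"

end


section \<open>The conformal superalgebra of a matrix superalgebra\<close>

text \<open>
  A \<open>k \<times> k\<close> matrix with \<open>k = k\<^sub>1 + k\<^sub>2\<close> is indexed by the sum type \<open>'m + 'n\<close>, where
  \<open>k\<^sub>1 = CARD('m)\<close> and \<open>k\<^sub>2 = CARD('n)\<close>: the index \<open>p \<le> k\<^sub>1\<close> is an \<open>Inl p\<close>, the index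
  \<open>k\<^sub>1 + q\<close> is an \<open>Inr q\<close>.

  An element of the ambient space below is a finitely supported family of matrices, its value at
  \<open>(i, j, m, n)\<close> being the coefficient of \<open>t\<^sub>1\<^sup>m t\<^sub>2\<^sup>n\<close> in the \<open>(i, j)\<close>-summand.  The space
  \<open>R(\<A>)\<close> consists of the families whose value at \<open>(i, j, m, n)\<close> lies in \<open>\<A>\<^bsub>i+j\<^esub>\<close>
  (block-diagonal if \<open>i + j = 0\<close>, block-off-diagonal if \<open>i + j = 1\<close>); the formulas for \<open>\<partial>\<close>
  and \<open>Y\<^sup>+\<close> make sense on the whole ambient space and restrict to it.
\<close>

type_synonym ('a, 'm, 'n) RA = "(bit \<times> bit \<times> nat \<times> nat) \<Rightarrow>\<^sub>0 ('a ^ ('m + 'n) ^ ('m + 'n))"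

definition RA_scale :: "'a::field_char_0 \<Rightarrow> ('a, 'm::finite, 'n::finite) RA \<Rightarrow> ('a, 'm, 'n) RA" where
  "RA_scale c x = Poly_Mapping.map (\<lambda>A. \<chi> p q. c * A $ p $ q) x"

lemma lookup_RA_scale: "Poly_Mapping.lookup (RA_scale c x) a $ p $ q = c * Poly_Mapping.lookup x a $ p $ q"
  by (simp add: RA_scale_def Poly_Mapping.map.rep_eq when_def)

interpretation RA: vector_space RA_scale
  by unfold_locales
    (auto intro!: poly_mapping_eqI simp: vec_eq_iff lookup_RA_scale lookup_add algebra_simps)

definition elt :: "'a::field_char_0 ^ ('m::finite + 'n::finite) ^ ('m + 'n) \<Rightarrow>
    bit \<Rightarrow> bit \<Rightarrow> nat \<Rightarrow> nat \<Rightarrow> ('a, 'm, 'n) RA" where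
  "elt A i j m n = Poly_Mapping.single (i, j, m, n) A"

definition matrix_unit :: "'k::finite \<Rightarrow> 'k \<Rightarrow> 'a::zero_neq_one ^ 'k ^ 'k" where
  "matrix_unit p q = (\<chi> r s. if r = p \<and> s = q then 1 else 0)"

definition kdelta :: "bit \<Rightarrow> bit \<Rightarrow> nat" where
  "kdelta i j = (if i = j then 1 else 0)"

definition RA_deriv :: "('a::field_char_0, 'm::finite, 'n::finite) RA \<Rightarrow> ('a, 'm, 'n) RA" where
  "RA_deriv x = (\<Sum>(i, j, m, n) \<in> Poly_Mapping.keys x.
     RA_scale (of_nat (m + 1)) (elt (Poly_Mapping.lookup x (i, j, m, n)) i j (m + 1) n) +
     RA_scale (of_nat (n + 1)) (elt (Poly_Mapping.lookup x (i, j, m, n)) i j m (n + 1)))"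

fun RA_Y_elt :: "'a::field_char_0 ^ ('m::finite + 'n::finite) ^ ('m + 'n) \<Rightarrow> bit \<times> bit \<times> nat \<times> nat \<Rightarrow>
    'a ^ ('m + 'n) ^ ('m + 'n) \<Rightarrow> bit \<times> bit \<times> nat \<times> nat \<Rightarrow> (int \<Rightarrow>\<^sub>0 ('a, 'm, 'n) RA)" where
  "RA_Y_elt u (i1, i2, m1, m2) v (j1, j2, n1, n2) =
     (\<Sum>p \<le> m1 + m2 + n1 + kdelta i2 0.
        Poly_Mapping.single (int p - int m1 - int m2 - int n1 - 1 - int (kdelta i2 0))
          (RA_scale
            (of_nat (kdelta i2 j1) * of_nat (n1 * kdelta i2 0 + 1)
              * (of_int (- int n1 - 1 - int (kdelta i2 0)) gchoose m2) * of_nat (p choose m1))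
            (elt (u ** v) i1 j2 p n2)))
   - (\<Sum>q \<le> m1 + m2 + n2 + kdelta i1 0.
        Poly_Mapping.single (int q - int m1 - int m2 - int n2 - 1 - int (kdelta i1 0))
          (RA_scale
            (koszul_sign (i1 + i2) (j1 + j2) * of_nat (kdelta i1 j2)
              * (of_nat (kdelta i1 1) - of_nat ((n2 + 1) * kdelta i1 0))
              * (of_int (- int n2 - 1 - int (kdelta i1 0)) gchoose m1) * of_nat (q choose m2))
            (elt (v ** u) j1 i2 n1 q)))"

definition RA_Y :: "('a::field_char_0, 'm::finite, 'n::finite) RA \<Rightarrow> ('a, 'm, 'n) RA \<Rightarrow>
    (int \<Rightarrow>\<^sub>0 ('a, 'm, 'n) RA)" where
  "RA_Y x y = (\<Sum>a \<in> Poly_Mapping.keys x. \<Sum>b \<in> Poly_Mapping.keys y.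
     RA_Y_elt (Poly_Mapping.lookup x a) a (Poly_Mapping.lookup y b) b)"

definition weight :: "bit \<times> bit \<times> nat \<times> nat \<Rightarrow> rat" where
  "weight = (\<lambda>(i, j, m, n). of_nat (m + n) + of_nat (kdelta i 0) + of_nat (kdelta j 0)
     + of_nat (kdelta i 1 + kdelta j 1) / 2)"

definition weight_space :: "('a::field_char_0, 'm::finite, 'n::finite) RA set \<Rightarrow> rat \<Rightarrow>
    ('a, 'm, 'n) RA set" where
  "weight_space V w = {x \<in> V. \<forall>a \<in> Poly_Mapping.keys x. weight a = w}"

text \<open>\<open>Rsub l i\<close> is the part of parity \<open>i\<close> of \<open>R\<^bsub>[k\<^sub>1,k\<^sub>2],l+1\<^esub>\<close>.\<close>

definition Rsub :: "nat \<Rightarrow> bit \<Rightarrow> ('a::field_char_0, 'm::finite, 'n::finite) RA set" where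
  "Rsub l i =
    (if i = 0
     then RA.span
       ({elt (matrix_unit (Inl p) (Inl q)) 0 0 m (l + n) | p q m n. True} \<union>
        {elt (matrix_unit (Inr p) (Inr q)) 1 1 m (l + n) | p q m n. True})
     else RA.span
       ({elt (matrix_unit (Inl p) (Inr q)) 0 1 m (l + n) | p q m n. True} \<union>
        {elt (matrix_unit (Inr q) (Inl p)) 1 0 m (l + n) | p q m n. True}))"

end

theory Submission
  imports Defs "HOL-Computational_Algebra.Polynomial"
begin

text \<open>
  Send \<open>u\<^bsub>[i,j]\<^esub>(m,n)\<close> to \<open>u x\<^sup>m y\<^sup>n / (m! n!)\<close>.  Then \<open>\<partial>\<close> is multiplication by \<open>x + y\<close>, and
  \<open>\<Sum>\<^sub>n c\<^sup>n / n! (f\<^sub>n g)\<close> becomes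
  \<open>f(x, -c-x) W(x+c) g(x+c, y) \<mp> g(x, y+c) W(-y-c) f(-c-y, y)\<close>, where \<open>W(x)\<close> is the diagonal matrix
  with \<open>x\<close> on the first block and \<open>1\<close> on the second.  In this form skew-symmetry and the commutator
  formula reduce to associativity of the matrix product; coefficients are recovered by evaluating
  at all scalars.

  Simplicity: acting on a nonzero element of an ideal by \<open>E\<^sub>k\<^sub>i x\<^sup>a y\<^sup>r\<close> with \<open>r\<close> large, the leading power of
  \<open>c\<close> only sees the first summand and produces a row with entries in \<open>x\<^sup>a F[y]\<close>; acting then by
  \<open>E\<^sub>q\<^sub>j x\<^sup>e y\<^sup>s\<close> with \<open>e\<close> large, the leading power only sees the second summand and
  produces \<open>E\<^sub>k\<^sub>j x\<^sup>a y\<^sup>s\<close>.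

  Generation: the span of the monomials is closed under all modes.  If a third index is available,
  it isolates \<open>E\<^sub>2\<^sub>2 y\<^bsup>l+1\<^esup>\<close> from the generators of weight \<open>l + 3/2\<close>; this element then allows one
  to raise both exponents one step at a time.
\<close>

subsection \<open>Additive functionals on finitely supported functions\<close>

text \<open>The sum over modes is the lambda-bracket with c as lambda, so the axioms take their
  lambda-bracket form: skew-symmetry replaces c by -c-x-y, and the commutator formula becomes a
  Jacobi identity whose right side has parameter c+d. Origin of W: after division by the factorials,
  binom(p, m_1) and the powers of z form a binomial expansion; the prefactor (n_1 delta + 1)
  binom(-n_1-1-delta, m_2) cancels the remaining factorial, and the shift delta survives as one
  factor x+c on the first block. The sign in the second half is that of W at the negated argument.
  The recurring obstacle is that a product of basis elements has two halves, of which only one is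
  wanted. The other is absent when its matrix indices do not match, and otherwise has to be killed
  by a binomial whose lower entry is too large. This separates k = 2 from k > 2: the l-th mode of
  E_12 y^l on E_21 y^l contains both E_11 y^l and E_22 y^(l+1) with nonzero coefficients, and only a
  third index offers products with unmatched outer indices.\<close>

definition psum :: "('k \<Rightarrow> 'b::ab_group_add \<Rightarrow> 'c::ab_group_add) \<Rightarrow> ('k \<Rightarrow>\<^sub>0 'b) \<Rightarrow> 'c" where
  "psum f x = (\<Sum>a\<in>Poly_Mapping.keys x. f a (Poly_Mapping.lookup x a))"

lemma psum_superset:
  assumes "finite A" "Poly_Mapping.keys x \<subseteq> A" "\<And>a. f a 0 = 0"
  shows "psum f x = (\<Sum>a\<in>A. f a (Poly_Mapping.lookup x a))"
  unfolding psum_def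
  by (rule sum.mono_neutral_left) (use assms in \<open>auto simp: in_keys_iff\<close>)

lemma additive_psum:
  assumes "\<And>a. Modules.additive (f a)"
  shows "Modules.additive (psum f)"
proof
  fix x y :: "'a \<Rightarrow>\<^sub>0 'b"
  let ?A = "Poly_Mapping.keys x \<union> Poly_Mapping.keys y"
  have z: "f a 0 = 0" for a
    using assms by (rule additive.zero)
  have "psum f (x + y) = (\<Sum>a\<in>?A. f a (Poly_Mapping.lookup (x + y) a))"
    by (rule psum_superset) (auto simp: z intro: Poly_Mapping.keys_add[THEN subsetD, THEN UnE])
  also have "\<dots> = (\<Sum>a\<in>?A. f a (Poly_Mapping.lookup x a)) + (\<Sum>a\<in>?A. f a (Poly_Mapping.lookup y a))"
    by (simp add: lookup_add additive.add[OF assms] sum.distrib)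
  also have "\<dots> = psum f x + psum f y"
    by (subst (1 2) psum_superset[of ?A]) (auto simp: z)
  finally show "psum f (x + y) = psum f x + psum f y" .
qed

lemma psum_single:
  assumes "Modules.additive (f a)"
  shows "psum f (Poly_Mapping.single a A) = f a A"
  using additive.zero[OF assms] by (simp add: psum_def)

lemma additive_psum_param:
  assumes "\<And>a A. Modules.additive (\<lambda>y. f y a A)"
  shows "Modules.additive (\<lambda>y. psum (f y) x)"
  unfolding psum_def
  by standard (simp add: additive.add[OF assms] sum.distrib)

lemma additive_compose:
  "Modules.additive f \<Longrightarrow> Modules.additive g \<Longrightarrow> Modules.additive (\<lambda>x. f (g x))"
  by (simp add: Modules.additive_def)

lemma additive_psum_apply:
  "Modules.additive g \<Longrightarrow> g (psum f x) = psum (\<lambda>a A. g (f a A)) x"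
  by (simp add: psum_def additive.sum)

lemma additive_lookup: "Modules.additive (\<lambda>x. Poly_Mapping.lookup x a)"
  by standard (simp add: lookup_add)

text \<open>Together with \<open>additive_psum_apply\<close> this reduces an identity between
  additive maps to singles; \<open>RA_deriv\<close>, \<open>RA_Y\<close>, \<open>ev\<close> and
  \<open>lam\<close> are all treated in this way.\<close>

lemma poly_mapping_eq_psum: "x = psum Poly_Mapping.single x"
proof (rule poly_mapping_eqI)
  fix k
  have "Poly_Mapping.lookup (psum Poly_Mapping.single x) k
      = psum (\<lambda>a A. Poly_Mapping.lookup (Poly_Mapping.single a A) k) x"
    by (rule additive_psum_apply[OF additive_lookup])
  also have "\<dots> = (\<Sum>a\<in>Poly_Mapping.keys x. if a = k then Poly_Mapping.lookup x k else 0)"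
    unfolding psum_def by (rule sum.cong) (auto simp: lookup_single when_def)
  also have "\<dots> = Poly_Mapping.lookup x k"
    by (simp add: in_keys_iff)
  finally show "Poly_Mapping.lookup x k = Poly_Mapping.lookup (psum Poly_Mapping.single x) k" ..
qed

subsection \<open>Matrices\<close>

definition cmat :: "'a::semiring_1 \<Rightarrow> 'a ^ 'k ^ 'l \<Rightarrow> 'a ^ 'k ^ 'l" where
  "cmat c A = (\<chi> p q. c * A $ p $ q)"

lemma cmat_nth [simp]: "cmat c A $ p $ q = c * A $ p $ q"
  by (simp add: cmat_def)

lemma additive_cmat: "Modules.additive (cmat (c :: 'a::ring_1))"
  by standard (simp add: vec_eq_iff algebra_simps)

lemma cmat_simps [simp]:
  "cmat 0 A = 0" "cmat 1 A = A" "cmat c (0 :: 'a::ring_1 ^ 'k ^ 'l) = 0"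
  "cmat (-1) (B :: 'a::ring_1 ^ 'k ^ 'l) = - B"
  "cmat c (cmat d A) = cmat (c * d) A"
  by (simp_all add: vec_eq_iff mult.assoc)

lemma cmat_add: "cmat (c :: 'a::ring_1) (A + B) = cmat c A + cmat c B"
  and cmat_diff: "cmat (c :: 'a::ring_1) (A - B) = cmat c A - cmat c B"
  and cmat_minus: "cmat (c :: 'a::ring_1) (- A) = - cmat c A"
  and cmat_sum: "cmat (c :: 'a::ring_1) (\<Sum>i\<in>I. f i) = (\<Sum>i\<in>I. cmat c (f i))"
  by (simp_all add: additive.add[OF additive_cmat] additive.diff[OF additive_cmat]
      additive.minus[OF additive_cmat] additive.sum[OF additive_cmat])

lemma cmat_add_left: "cmat (c + d :: 'a::ring_1) A = cmat c A + cmat d A"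
  and cmat_sum_left: "cmat (\<Sum>i\<in>I. g i :: 'a::ring_1) A = (\<Sum>i\<in>I. cmat (g i) A)"
  by (simp_all add: vec_eq_iff algebra_simps sum_distrib_right)

lemma additive_matrix_mult_left: "Modules.additive (\<lambda>A. A ** (B :: 'a::ring_1 ^ 'k ^ 'l))"
  by standard (simp add: matrix_matrix_mult_def vec_eq_iff algebra_simps sum.distrib)

lemma additive_matrix_mult_right: "Modules.additive (\<lambda>B. (A :: 'a::ring_1 ^ 'l ^ 'k) ** B)"
  by standard (rule matrix_add_ldistrib)

lemmas matrix_mult_simps =
  additive.add[OF additive_matrix_mult_left] additive.add[OF additive_matrix_mult_right]
  additive.diff[OF additive_matrix_mult_left] additive.diff[OF additive_matrix_mult_right]
  additive.minus[OF additive_matrix_mult_left] additive.minus[OF additive_matrix_mult_right]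
  additive.zero[OF additive_matrix_mult_left] additive.zero[OF additive_matrix_mult_right]

lemma cmat_matrix_mult [simp]:
  "cmat (c :: 'a::comm_ring_1) A ** B = cmat c (A ** B)"
  "A ** cmat (c :: 'a::comm_ring_1) B = cmat c (A ** B)"
  by (simp_all add: matrix_matrix_mult_def vec_eq_iff sum_distrib_left algebra_simps)

lemma matrix_unit_nth [simp]:
  "matrix_unit p q $ r $ s = (if r = p \<and> s = q then 1 else 0)"
  by (simp add: matrix_unit_def)

lemma matrix_unit_mult:
  "matrix_unit p q ** matrix_unit r s = (if q = r then matrix_unit p s else (0 :: 'a::ring_1 ^ 'k ^ 'k))"
  by (auto simp: matrix_matrix_mult_def vec_eq_iff if_distrib[of "\<lambda>x. x * _"] cong: if_cong)

lemma matrix_eq_sum_units: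
  "(A :: 'a::ring_1 ^ 'k ^ 'k) = (\<Sum>p\<in>UNIV. \<Sum>q\<in>UNIV. cmat (A $ p $ q) (matrix_unit p q))"
proof -
  have "(\<Sum>p\<in>UNIV. \<Sum>q\<in>UNIV. A $ p $ q * (if r = p \<and> s = q then 1 else 0)) = A $ r $ s" for r s
  proof -
    have "(\<Sum>q\<in>UNIV. A $ p $ q * (if r = p \<and> s = q then 1 else 0)) = (if r = p then A $ r $ s else 0)" for p
      by (simp add: if_distrib cong: if_cong)
    thus ?thesis
      by simp
  qed
  thus ?thesis
    by (simp add: vec_eq_iff)
qed

subsection \<open>Extracting coefficients of polynomial functions\<close>

text \<open>A field of characteristic 0 is infinite, so a polynomial is determined by its values;
  formal variables can therefore be replaced by scalars throughout.\<close>

lemma polyfun_coeff_eq: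
  fixes f g :: "nat \<Rightarrow> 'a::field_char_0"
  assumes "\<And>x. (\<Sum>n\<le>K. x ^ n * f n) = (\<Sum>n\<le>K. x ^ n * g n)" "n \<le> K"
  shows "f n = g n"
proof -
  have "poly (\<Sum>n\<le>K. monom (f n) n) = poly (\<Sum>n\<le>K. monom (g n) n)"
    by (rule ext) (use assms(1) in \<open>simp add: poly_sum poly_monom mult.commute\<close>)
  hence "(\<Sum>n\<le>K. monom (f n) n) = (\<Sum>n\<le>K. monom (g n) n)"
    by (simp only: poly_eq_poly_eq_iff)
  hence "coeff (\<Sum>n\<le>K. monom (f n) n) n = coeff (\<Sum>n\<le>K. monom (g n) n) n"
    by simp
  thus ?thesis
    using assms(2) by (simp add: coeff_sum)
qed

lemma polyfun2_coeff_eq: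
  fixes f g :: "nat \<Rightarrow> nat \<Rightarrow> 'a::field_char_0"
  assumes "\<And>x y. (\<Sum>m\<le>K. \<Sum>n\<le>K. x ^ m * y ^ n * f m n) = (\<Sum>m\<le>K. \<Sum>n\<le>K. x ^ m * y ^ n * g m n)"
    and "m \<le> K" "n \<le> K"
  shows "f m n = g m n"
proof -
  have "(\<Sum>n\<le>K. y ^ n * f m n) = (\<Sum>n\<le>K. y ^ n * g m n)" for y
    by (rule polyfun_coeff_eq[where K = K and f = "\<lambda>m. \<Sum>n\<le>K. y ^ n * f m n"
          and g = "\<lambda>m. \<Sum>n\<le>K. y ^ n * g m n"])
      (use assms(1)[of _ y] assms(2) in \<open>simp_all add: sum_distrib_left mult.assoc\<close>)
  thus ?thesis
    by (rule polyfun_coeff_eq) fact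
qed

subsection \<open>The homogeneous parts of the algebra\<close>

fun lab :: "'m + 'n \<Rightarrow> bit" where
  "lab (Inl p) = 0"
| "lab (Inr q) = 1"

abbreviation wt :: "'m + 'n \<Rightarrow> nat" where
  "wt p \<equiv> kdelta (lab p) 0"

text \<open>The labels are read off from the matrix position, which merges the four families
  spanning \<open>Rsub\<close> into one.\<close>

definition unit_elt :: "'m::finite + 'n::finite \<Rightarrow> 'm + 'n \<Rightarrow> nat \<Rightarrow> nat \<Rightarrow> ('a::field_char_0, 'm, 'n) RA" where
  "unit_elt p q m n = elt (matrix_unit p q) (lab p) (lab q) m n"

text \<open>In R(A) the labels of a summand only fix the parity of its matrices; in the subalgebra
  they fix the block. This alignment lets matrix multiplication produce the Kronecker deltas of the
  product by itself.\<close>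

definition block :: "'a::field_char_0 ^ ('m::finite + 'n::finite) ^ ('m + 'n) \<Rightarrow> bit \<Rightarrow> bit \<Rightarrow> bool" where
  "block A i j \<longleftrightarrow> (\<forall>p q. A $ p $ q \<noteq> 0 \<longrightarrow> lab p = i \<and> lab q = j)"

lemma block_simps:
  "block 0 i j" "block A i j \<Longrightarrow> block B i j \<Longrightarrow> block (A + B) i j"
  "block A i j \<Longrightarrow> block (cmat c A) i j" "block (- A) i j = block A i j"
proof -
  show "block A i j \<Longrightarrow> block B i j \<Longrightarrow> block (A + B) i j"
    unfolding block_def by (metis add.right_neutral vector_add_component)
qed (auto simp: block_def)

lemma block_mult: "block A i j \<Longrightarrow> block B i' j' \<Longrightarrow> block (A ** B) i j'"
  by (auto simp: block_def matrix_matrix_mult_def elim!: sum.not_neutral_contains_not_neutral)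

lemma block_mult_eq_0: "block A i j \<Longrightarrow> block B i' j' \<Longrightarrow> j \<noteq> i' \<Longrightarrow> A ** B = 0"
  by (auto simp: block_def matrix_matrix_mult_def vec_eq_iff intro!: sum.neutral) metis

lemma block_matrix_unit: "block (matrix_unit p q) i j \<longleftrightarrow> lab p = i \<and> lab q = j"
  by (auto simp: block_def)

lemma RA_scale_lookup: "Poly_Mapping.lookup (RA_scale c x) a = cmat c (Poly_Mapping.lookup x a)"
  by (simp add: vec_eq_iff lookup_RA_scale)

lemma RA_scale_elt: "RA_scale c (elt A i j m n) = elt (cmat c A) i j m n"
  by (rule poly_mapping_eqI) (simp add: RA_scale_lookup elt_def lookup_single when_def)

lemma RA_scale_single: "RA_scale c (Poly_Mapping.single a A) = Poly_Mapping.single a (cmat c A)"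
  by (rule poly_mapping_eqI) (simp add: RA_scale_lookup lookup_single when_def)

lemma additive_RA_scale: "Modules.additive (RA_scale c)"
  by standard (rule RA.scale_right_distrib)

lemma additive_elt: "Modules.additive (\<lambda>A. elt A i j m n)"
  by standard (simp add: elt_def single_add)

text \<open>\<open>Rsub\<close> described by conditions on coefficients, the form that closure
  proofs can check; the two are identified in \<open>Rsub_eq_homog\<close>.\<close>

definition homog :: "nat \<Rightarrow> bit \<Rightarrow> ('a::field_char_0, 'm::finite, 'n::finite) RA set" where
  "homog l h = {x. \<forall>i j m n. (block (Poly_Mapping.lookup x (i, j, m, n)) i j) \<and>
     (Poly_Mapping.lookup x (i, j, m, n) \<noteq> 0 \<longrightarrow> i + j = h \<and> l \<le> n)}"

lemma subspace_blockwise: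
  "RA.subspace {x :: ('a::field_char_0, 'm::finite, 'n::finite) RA. \<forall>i j m n. block (Poly_Mapping.lookup x (i, j, m, n)) i j \<and>
     (Poly_Mapping.lookup x (i, j, m, n) \<noteq> 0 \<longrightarrow> P i j m n)}"
  unfolding RA.subspace_def mem_Collect_eq
proof (intro conjI ballI allI impI)
  fix x y :: "('a, 'm, 'n) RA" and c i j m n
  assume x: "x \<in> {x. \<forall>i j m n. block (Poly_Mapping.lookup x (i, j, m, n)) i j \<and>
     (Poly_Mapping.lookup x (i, j, m, n) \<noteq> 0 \<longrightarrow> P i j m n)}"
  thus "block (Poly_Mapping.lookup (RA_scale c x) (i, j, m, n)) i j"
    by (simp add: RA_scale_lookup block_simps)
  show "P i j m n" if "Poly_Mapping.lookup (RA_scale c x) (i, j, m, n) \<noteq> 0"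
    using that x by (cases "Poly_Mapping.lookup x (i, j, m, n) = 0") (auto simp: RA_scale_lookup)
  assume y: "y \<in> {x. \<forall>i j m n. block (Poly_Mapping.lookup x (i, j, m, n)) i j \<and>
     (Poly_Mapping.lookup x (i, j, m, n) \<noteq> 0 \<longrightarrow> P i j m n)}"
  show "block (Poly_Mapping.lookup (x + y) (i, j, m, n)) i j"
    using x y by (simp add: lookup_add block_simps)
  show "P i j m n" if "Poly_Mapping.lookup (x + y) (i, j, m, n) \<noteq> 0"
    using that x y by (cases "Poly_Mapping.lookup x (i, j, m, n) = 0") (auto simp: lookup_add)
qed (simp_all add: block_simps)

lemma subspace_homog: "RA.subspace (homog l h)"
  unfolding homog_def by (rule subspace_blockwise)

lemma single_in_homog:
  "block A i j \<Longrightarrow> i + j = h \<Longrightarrow> l \<le> n \<Longrightarrow> Poly_Mapping.single (i, j, m, n) A \<in> homog l h"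
  by (auto simp: homog_def lookup_single when_def block_simps)

lemma unit_elt_in_homog: "lab p + lab q = h \<Longrightarrow> l \<le> n \<Longrightarrow> unit_elt p q m n \<in> homog l h"
  by (simp add: unit_elt_def elt_def single_in_homog block_matrix_unit)

lemma elt_eq_sum_units:
  assumes "block A i j"
  shows "elt A i j m n = (\<Sum>p\<in>UNIV. \<Sum>q\<in>UNIV. RA_scale (A $ p $ q) (unit_elt p q m n))"
proof -
  have "elt A i j m n = (\<Sum>p\<in>UNIV. \<Sum>q\<in>UNIV. elt (cmat (A $ p $ q) (matrix_unit p q)) i j m n)"
    by (subst matrix_eq_sum_units) (simp add: additive.sum[OF additive_elt])
  also have "\<dots> = (\<Sum>p\<in>UNIV. \<Sum>q\<in>UNIV. RA_scale (A $ p $ q) (unit_elt p q m n))"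
  proof (intro sum.cong refl)
    fix p q
    show "elt (cmat (A $ p $ q) (matrix_unit p q)) i j m n = RA_scale (A $ p $ q) (unit_elt p q m n)"
    proof (cases "A $ p $ q = 0")
      case True
      thus ?thesis by (simp add: additive.zero[OF additive_elt])
    next
      case False
      with assms have "lab p = i" "lab q = j" by (auto simp: block_def)
      thus ?thesis by (simp add: unit_elt_def RA_scale_elt)
    qed
  qed
  finally show ?thesis .
qed

lemma homog_eq_span:
  "homog l h = (RA.span {unit_elt p q m n | p q m n. lab p + lab q = h \<and> l \<le> n}
    :: ('a::field_char_0, 'm::finite, 'n::finite) RA set)" (is "_ = RA.span ?B")
proof
  show "RA.span ?B \<subseteq> homog l h"
    by (rule RA.span_minimal) (auto intro: unit_elt_in_homog subspace_homog)
  show "homog l h \<subseteq> RA.span ?B"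
  proof
    fix x :: "('a, 'm, 'n) RA"
    assume x: "x \<in> homog l h"
    have "psum Poly_Mapping.single x \<in> RA.span ?B"
      unfolding psum_def
    proof (rule RA.span_sum)
      fix a assume "a \<in> Poly_Mapping.keys x"
      then obtain i j m n where a: "a = (i, j, m, n)" and nz: "Poly_Mapping.lookup x (i, j, m, n) \<noteq> 0"
        by (cases a) (auto simp: in_keys_iff)
      let ?A = "Poly_Mapping.lookup x (i, j, m, n)"
      have A: "block ?A i j" "i + j = h" "l \<le> n"
        using x nz by (auto simp: homog_def)
      have "elt ?A i j m n \<in> RA.span ?B"
        unfolding elt_eq_sum_units[OF A(1)]
      proof (intro RA.span_sum)
        fix p q
        show "RA_scale (?A $ p $ q) (unit_elt p q m n) \<in> RA.span ?B"
        proof (cases "?A $ p $ q = 0")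
          case False
          with A have "lab p = i" "lab q = j" by (auto simp: block_def)
          with A show ?thesis by (intro RA.span_scale RA.span_base) blast
        qed (simp add: RA.span_zero)
      qed
      thus "Poly_Mapping.single a (Poly_Mapping.lookup x a) \<in> RA.span ?B"
        by (simp add: a elt_def)
    qed
    thus "x \<in> RA.span ?B"
      by (simp flip: poly_mapping_eq_psum)
  qed
qed

lemma Rsub_eq_homog: "Rsub l = (homog l :: bit \<Rightarrow> ('a::field_char_0, 'm::finite, 'n::finite) RA set)"
proof
  fix h :: bit
  have ex: "(\<exists>n'. n = l + n' \<and> P) \<longleftrightarrow> l \<le> n \<and> P" for n P
    by (auto simp: le_iff_add)
  consider "h = 0" | "h = 1" by (cases h) auto
  thus "Rsub l h = (homog l h :: ('a, 'm, 'n) RA set)"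
  proof cases
    case 1
    have "{unit_elt p q m n :: ('a, 'm, 'n) RA | p q m n. lab p + lab q = h \<and> l \<le> n} =
      {elt (matrix_unit (Inl p) (Inl q)) 0 0 m (l + n) | p q m n. True} \<union>
        {elt (matrix_unit (Inr p) (Inr q)) 1 1 m (l + n) | p q m n. True}" (is "?L = ?A \<union> ?B")
    proof (intro equalityI subsetI)
      fix x assume "x \<in> ?L"
      then obtain p q m n where *: "x = unit_elt p q m (l + n)" "lab p + lab q = 0"
        using 1 by (auto simp: le_iff_add)
      show "x \<in> ?A \<union> ?B"
        using * by (cases p; cases q; simp add: unit_elt_def; blast)
    next
      fix x assume "x \<in> ?A \<union> ?B"
      thus "x \<in> ?L"
      proof
        assume "x \<in> ?A"
        then obtain p q m n where "x = unit_elt (Inl p) (Inl q) m (l + n)"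
          by (auto simp: unit_elt_def)
        thus ?thesis using 1 by fastforce
      next
        assume "x \<in> ?B"
        then obtain p q m n where "x = unit_elt (Inr p) (Inr q) m (l + n)"
          by (auto simp: unit_elt_def)
        thus ?thesis using 1 by fastforce
      qed
    qed
    thus ?thesis using 1 by (simp add: Rsub_def homog_eq_span)
  next
    case 2
    have "{unit_elt p q m n :: ('a, 'm, 'n) RA | p q m n. lab p + lab q = h \<and> l \<le> n} =
      {elt (matrix_unit (Inl p) (Inr q)) 0 1 m (l + n) | p q m n. True} \<union>
        {elt (matrix_unit (Inr q) (Inl p)) 1 0 m (l + n) | p q m n. True}" (is "?L = ?A \<union> ?B")
    proof (intro equalityI subsetI)
      fix x assume "x \<in> ?L"
      then obtain p q m n where *: "x = unit_elt p q m (l + n)" "lab p + lab q = 1"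
        using 2 by (auto simp: le_iff_add)
      show "x \<in> ?A \<union> ?B"
        using * by (cases p; cases q; simp add: unit_elt_def; blast)
    next
      fix x assume "x \<in> ?A \<union> ?B"
      thus "x \<in> ?L"
      proof
        assume "x \<in> ?A"
        then obtain p q m n where "x = unit_elt (Inl p) (Inr q) m (l + n)"
          by (auto simp: unit_elt_def)
        thus ?thesis using 2 by fastforce
      next
        assume "x \<in> ?B"
        then obtain p q m n where "x = unit_elt (Inr p) (Inl q) m (l + n)"
          by (auto simp: unit_elt_def)
        thus ?thesis using 2 by fastforce
      qed
    qed
    thus ?thesis using 2 by (simp add: Rsub_def homog_eq_span)
  qed
qed

definition aligned :: "nat \<Rightarrow> ('a::field_char_0, 'm::finite, 'n::finite) RA set" where
  "aligned l = {x. \<forall>i j m n. block (Poly_Mapping.lookup x (i, j, m, n)) i j \<and>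
     (Poly_Mapping.lookup x (i, j, m, n) \<noteq> 0 \<longrightarrow> l \<le> n)}"

lemma homog_subset_aligned: "homog l h \<subseteq> aligned l"
proof
  fix x assume "x \<in> homog l h"
  thus "x \<in> aligned l" unfolding homog_def aligned_def by blast
qed

lemma subspace_aligned: "RA.subspace (aligned l)"
  unfolding aligned_def by (rule subspace_blockwise)

lemma whole_homog: "whole (homog l) = (aligned l :: ('a::field_char_0, 'm::finite, 'n::finite) RA set)"
proof
  show "whole (homog l) \<subseteq> aligned l"
    using homog_subset_aligned RA.subspace_add[OF subspace_aligned] by (fastforce simp: whole_def)
  show "aligned l \<subseteq> (whole (homog l) :: ('a, 'm, 'n) RA set)"
  proof
    fix x :: "('a, 'm, 'n) RA" assume x: "x \<in> aligned l"
    define part where "part h = psum (\<lambda>(i, j, m, n) A. if i + j = h then Poly_Mapping.single (i, j, m, n) A else 0) x" for h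
    have "part h \<in> homog l h" for h
      unfolding part_def psum_def
    proof (intro RA.subspace_sum[OF subspace_homog])
      fix a assume "a \<in> Poly_Mapping.keys x"
      with x show "(case a of (i, j, m, n) \<Rightarrow> \<lambda>A. if i + j = h then Poly_Mapping.single (i, j, m, n) A else 0)
        (Poly_Mapping.lookup x a) \<in> homog l h"
        by (cases a) (auto simp: aligned_def in_keys_iff RA.subspace_0[OF subspace_homog] intro!: single_in_homog)
    qed
    moreover have "part 0 + part 1 = x"
    proof -
      have "part 0 + part 1 = psum Poly_Mapping.single x"
        unfolding part_def psum_def sum.distrib[symmetric]
      proof (intro sum.cong refl)
        fix a :: "bit \<times> bit \<times> nat \<times> nat"
        obtain i j m n where a: "a = (i, j, m, n)" by (cases a) auto
        have "i + j = 0 \<or> i + j = 1" by (cases "i + j") auto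
        thus "(case a of (i, j, m, n) \<Rightarrow> \<lambda>A. if i + j = 0 then Poly_Mapping.single (i, j, m, n) A else 0) (Poly_Mapping.lookup x a)
          + (case a of (i, j, m, n) \<Rightarrow> \<lambda>A. if i + j = 1 then Poly_Mapping.single (i, j, m, n) A else 0) (Poly_Mapping.lookup x a)
          = Poly_Mapping.single a (Poly_Mapping.lookup x a)"
          unfolding a by auto
      qed
      also have "\<dots> = x" by (rule poly_mapping_eq_psum[symmetric])
      finally show "part 0 + part 1 = x" .
    qed
    ultimately show "x \<in> whole (homog l)"
      unfolding whole_def by blast
  qed
qed

lemma aligned_eq_span: "aligned l = RA.span {unit_elt p q m n | p q m n. l \<le> n}" (is "_ = RA.span ?B")
proof
  show "RA.span ?B \<subseteq> aligned l"
    by (rule RA.span_minimal) (use subspace_aligned homog_subset_aligned unit_elt_in_homog in blast)+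
  have "homog l h \<subseteq> RA.span ?B" for h
    unfolding homog_eq_span by (rule RA.span_mono) blast
  thus "aligned l \<subseteq> RA.span ?B"
    unfolding whole_homog[symmetric] whole_def by (blast intro: RA.span_add)
qed

lemma homog_direct: "homog l 0 \<inter> homog l 1 = {0 :: ('a::field_char_0, 'm::finite, 'n::finite) RA}"
proof -
  have "x = 0" if "x \<in> homog l 0" "x \<in> homog l 1" for x :: "('a, 'm, 'n) RA"
  proof (rule poly_mapping_eqI)
    fix a :: "bit \<times> bit \<times> nat \<times> nat"
    obtain i j m n where "a = (i, j, m, n)" by (cases a) auto
    with that show "Poly_Mapping.lookup x a = Poly_Mapping.lookup 0 a"
      by (force simp: homog_def)
  qed
  thus ?thesis using RA.subspace_0[OF subspace_homog] by blast
qed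

subsection \<open>Generating functions\<close>

definition ev :: "'a \<Rightarrow> 'a \<Rightarrow> ('a::field_char_0, 'm::finite, 'n::finite) RA \<Rightarrow> 'a ^ ('m + 'n) ^ ('m + 'n)" where
  "ev s t = psum (\<lambda>(i, j, m, n). cmat (s ^ m * t ^ n / (fact m * fact n)))"

text \<open>The lambda-bracket at lambda = c, evaluated at (s, t). The exponent of the n-th mode is
  e = -n-1, so \<open>nat (- e - 1)\<close> recovers n.\<close>

definition lam :: "'a \<Rightarrow> 'a \<Rightarrow> 'a \<Rightarrow> (int \<Rightarrow>\<^sub>0 ('a::field_char_0, 'm::finite, 'n::finite) RA) \<Rightarrow> 'a ^ ('m + 'n) ^ ('m + 'n)" where
  "lam c s t = psum (\<lambda>e z. cmat (c ^ nat (- e - 1) / fact (nat (- e - 1))) (ev s t z))"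

definition twist :: "'a::field_char_0 \<Rightarrow> 'a ^ ('m::finite + 'n::finite) ^ ('m + 'n)" where
  "twist x = (\<chi> p q. if p = q then x ^ wt p else 0)"

lemma additive_ev: "Modules.additive (ev s t)"
  unfolding ev_def by (rule additive_psum) (auto simp: additive_cmat split: prod.split)

lemma additive_lam: "Modules.additive (lam c s t)"
  unfolding lam_def by (rule additive_psum) (rule additive_compose[OF additive_cmat additive_ev])

lemma ev_single: "ev s t (Poly_Mapping.single (i, j, m, n) A) = cmat (s ^ m * t ^ n / (fact m * fact n)) A"
  unfolding ev_def by (subst psum_single) (auto simp: additive_cmat)

lemma psum_RA_scale:
  assumes f: "\<And>a. Modules.additive (f a)" and S: "Modules.additive S"
    and c: "\<And>a A. f a (cmat c A) = S (f a A)"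
  shows "psum f (RA_scale c x) = S (psum f x)"
proof -
  have "psum f (RA_scale c x) = psum f (RA_scale c (psum Poly_Mapping.single x))"
    by (simp flip: poly_mapping_eq_psum)
  also have "\<dots> = psum (\<lambda>a A. psum f (RA_scale c (Poly_Mapping.single a A))) x"
    by (rule additive_psum_apply) (rule additive_compose[OF additive_psum[OF f] additive_RA_scale])
  also have "\<dots> = psum (\<lambda>a A. S (f a A)) x"
    by (simp add: RA_scale_single psum_single[OF f] c)
  also have "\<dots> = S (psum f x)"
    by (rule additive_psum_apply[OF S, symmetric])
  finally show ?thesis .
qed

lemma ev_RA_scale: "ev s t (RA_scale c x) = cmat c (ev s t x)"
  unfolding ev_def
  by (rule psum_RA_scale) (auto simp: additive_cmat mult.commute split: prod.split)

lemma lam_single: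
  "lam c s t (Poly_Mapping.single e z) = cmat (c ^ nat (- e - 1) / fact (nat (- e - 1))) (ev s t z)"
  unfolding lam_def by (subst psum_single) (auto intro: additive_compose[OF additive_cmat additive_ev])

text \<open>Terms with p < m vanish. For p = m + r the quotient binom(m+r, m) / (m+r)! equals 1 /
  (m! r!), and the binomial theorem for (s + c)^L remains.\<close>

lemma binomial_exp_sum:
  fixes s c :: "'a::field_char_0"
  shows "(\<Sum>p\<le>m + L. c ^ (m + L - p) / fact (m + L - p) * of_nat (p choose m) * (s ^ p / fact p))
    = s ^ m / fact m * ((s + c) ^ L / fact L)"
proof -
  have "(\<Sum>p\<le>m + L. c ^ (m + L - p) / fact (m + L - p) * of_nat (p choose m) * (s ^ p / fact p))
     = (\<Sum>p=m..m + L. c ^ (m + L - p) / fact (m + L - p) * of_nat (p choose m) * (s ^ p / fact p))"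
    by (rule sum.mono_neutral_right) auto
  also have "\<dots> = (\<Sum>r\<le>L. c ^ (L - r) / fact (L - r) * of_nat ((m + r) choose m) * (s ^ (m + r) / fact (m + r)))"
    by (subst sum.atLeastAtMost_shift_0) (simp_all add: atLeast0AtMost)
  also have "\<dots> = (\<Sum>r\<le>L. s ^ m / fact m * (of_nat (L choose r) * s ^ r * c ^ (L - r) / fact L))"
  proof (rule sum.cong[OF refl])
    fix r assume "r \<in> {..L}"
    hence "of_nat (L choose r) = (fact L / (fact r * fact (L - r)) :: 'a)"
      by (simp add: binomial_fact)
    moreover have "of_nat ((m + r) choose m) = (fact (m + r) / (fact m * fact r) :: 'a)"
      by (simp add: binomial_fact)
    ultimately show "c ^ (L - r) / fact (L - r) * of_nat ((m + r) choose m) * (s ^ (m + r) / fact (m + r))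
      = s ^ m / fact m * (of_nat (L choose r) * s ^ r * c ^ (L - r) / fact L)"
      by (simp add: power_add mult_ac)
  qed
  also have "\<dots> = s ^ m / fact m * ((s + c) ^ L / fact L)"
    by (simp only: binomial_ring sum_divide_distrib sum_distrib_left)
  finally show ?thesis .
qed

lemma gbinomial_minus_nat:
  "(- of_nat (Suc N) gchoose k :: 'a::field_char_0) = (- 1) ^ k * (fact (N + k) / (fact k * fact N))"
proof -
  have "(- of_nat (Suc N) gchoose k :: 'a) = (- 1) ^ k * (of_nat (N + k) gchoose k)"
    by (subst gbinomial_minus) simp
  also have "(of_nat (N + k) gchoose k :: 'a) = of_nat ((N + k) choose k)"
    by (rule binomial_gbinomial[symmetric])
  also have "\<dots> = fact (N + k) / (fact k * fact N)"
    by (simp add: binomial_fact)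
  finally show ?thesis .
qed

text \<open>By upper negation the binomial is (-1)^m2 (n+d+m2)! / (m2! (n+d)!). As d is 0 or 1, the
  factor n d + 1 turns (n+d)! into n!, and (n+d+m2)! cancels the L! of
  \<open>binomial_exp_sum\<close> for L = m2+n+d.\<close>

lemma half_product_genfun:
  fixes s c :: "'a::field_char_0"
  assumes "d \<le> 1"
  shows "(\<Sum>p\<le>m1 + m2 + n + d. c ^ (m1 + m2 + n + d - p) / fact (m1 + m2 + n + d - p) *
      (of_nat (n * d + 1) * (of_int (- int n - 1 - int d) gchoose m2) * of_nat (p choose m1)) * (s ^ p / fact p))
    = s ^ m1 * (- c - s) ^ m2 / (fact m1 * fact m2) * (s + c) ^ d * ((s + c) ^ n / fact n)"
    (is "?L = ?R")
proof -
  have g: "of_nat (n * d + 1) * (of_int (- int n - 1 - int d) gchoose m2)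
     = ((- 1) ^ m2 * (fact (n + d + m2) / (fact m2 * fact n)) :: 'a)"
  proof -
    have e: "(of_int (- int n - 1 - int d) :: 'a) = - of_nat (Suc (n + d))"
      by simp
    have ff: "(of_nat (n * d + 1) :: 'a) / fact (n + d) = 1 / fact n"
    proof -
      have "d = 0 \<or> d = 1" using assms by linarith
      moreover have "of_nat (Suc n) / fact (Suc n) = (1 :: 'a) / fact n"
        by (simp add: fact_Suc del: of_nat_Suc)
      ultimately show ?thesis by auto
    qed
    have key: "a * (b * (x / (y * f))) = b * (x / (y * g))" if "a / f = 1 / g" for a b x y f g :: 'a
    proof -
      have "a * (b * (x / (y * f))) = b * (x / y) * (a / f)" by (simp add: mult_ac)
      thus ?thesis unfolding that by simp
    qed
    show ?thesis
      unfolding e gbinomial_minus_nat by (rule key[OF ff])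
  qed
  have "?L = (- 1) ^ m2 * (fact (n + d + m2) / (fact m2 * fact n)) *
     (\<Sum>p\<le>m1 + (m2 + n + d). c ^ (m1 + (m2 + n + d) - p) / fact (m1 + (m2 + n + d) - p) *
      of_nat (p choose m1) * (s ^ p / fact p))"
    unfolding g sum_distrib_left by (intro sum.cong) (auto simp: algebra_simps)
  also have "\<dots> = (- 1) ^ m2 * (fact (n + d + m2) / (fact m2 * fact n)) *
     (s ^ m1 / fact m1 * ((s + c) ^ (m2 + n + d) / fact (m2 + n + d)))"
    by (simp only: binomial_exp_sum)
  also have "\<dots> = s ^ m1 / fact m1 * ((- 1) ^ m2 * (s + c) ^ m2) / (fact m2 * fact n) * (s + c) ^ n * (s + c) ^ d"
    by (simp add: power_add add_ac mult_ac)
  also have "(- 1) ^ m2 * (s + c) ^ m2 = (- c - s) ^ m2"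
    by (simp add: minus_diff_commute flip: power_mult_distrib)
  finally show ?thesis
    by (simp add: mult_ac)
qed

text \<open>All nonzero columns of A lie in block i2, on which \<open>twist x\<close> is a scalar;
  the delta appears because A ** B = 0 for i2 different from j1.\<close>

lemma twist_mult:
  assumes "block A i1 i2" "block B j1 j2"
  shows "A ** twist x ** B = cmat (of_nat (kdelta i2 j1) * x ^ kdelta i2 0) (A ** B)"
proof -
  have "(A ** twist x) $ p $ q = cmat (x ^ kdelta i2 0) A $ p $ q" for p q
  proof -
    have "(A ** twist x) $ p $ q = A $ p $ q * x ^ wt q"
      by (simp add: matrix_matrix_mult_def twist_def if_distrib cong: if_cong)
    thus ?thesis
      using assms(1) by (cases "A $ p $ q = 0") (auto simp: block_def)
  qed
  hence "A ** twist x = cmat (x ^ kdelta i2 0) A"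
    by (simp add: vec_eq_iff)
  moreover have "A ** B = 0" if "i2 \<noteq> j1"
    using block_mult_eq_0[OF assms that] .
  ultimately show ?thesis
    by (auto simp: kdelta_def)
qed

text \<open>The arguments are arbitrary matrix functions, not only values of \<open>ev\<close>, so
  that brackets can be nested in the Jacobi identity.\<close>

definition super_bracket where
  "super_bracket e c s t U V = U s (- c - s) ** twist (s + c) ** V (s + c) t
     - cmat e (V s (t + c) ** twist (- (t + c)) ** U (- c - t) t)"

text \<open>The halves of \<open>RA_Y_elt\<close> are mirror images: exchanging m1 with m2, n1 with
  n2 and s with t turns the scalar sum of one into that of the other up to sign, so
  \<open>half_product_genfun\<close> evaluates both.\<close>

lemma lam_RA_Y_elt:
  assumes "block A i1 i2" "block B j1 j2"
  shows "lam c s t (RA_Y_elt A (i1, i2, m1, m2) B (j1, j2, n1, n2))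
    = super_bracket (koszul_sign (i1 + i2) (j1 + j2)) c s t
       (\<lambda>s t. ev s t (Poly_Mapping.single (i1, i2, m1, m2) A))
       (\<lambda>s t. ev s t (Poly_Mapping.single (j1, j2, n1, n2) B))"
proof -
  define K L where "K = m1 + m2 + n1 + kdelta i2 0" and "L = m1 + m2 + n2 + kdelta i1 0"
  have k1: "kdelta i2 0 \<le> 1" "kdelta i1 0 \<le> 1"
    by (auto simp: kdelta_def)
  have e1: "nat (- (int p - int m1 - int m2 - int n1 - 1 - int (kdelta i2 0)) - 1) = K - p" for p
    unfolding K_def by linarith
  have e2: "nat (- (int p - int m1 - int m2 - int n2 - 1 - int (kdelta i1 0)) - 1) = L - p" for p
    unfolding L_def by linarith
  \<comment> \<open>This sign is what the negated argument of \<open>twist\<close> contributes in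
    the second summand of \<open>super_bracket\<close>.\<close>
  have sg: "(of_nat (kdelta i1 1) - of_nat ((n2 + 1) * kdelta i1 0) :: 'a)
      = (- 1) ^ kdelta i1 0 * of_nat (n2 * kdelta i1 0 + 1)"
    by (cases i1) (auto simp: kdelta_def)
  let ?e = "koszul_sign (i1 + i2) (j1 + j2) :: 'a"
  have "lam c s t (\<Sum>p \<le> K.
        Poly_Mapping.single (int p - int m1 - int m2 - int n1 - 1 - int (kdelta i2 0))
          (RA_scale
            (of_nat (kdelta i2 j1) * of_nat (n1 * kdelta i2 0 + 1)
              * (of_int (- int n1 - 1 - int (kdelta i2 0)) gchoose m2) * of_nat (p choose m1))
            (elt (A ** B) i1 j2 p n2)))
    = cmat (of_nat (kdelta i2 j1) * (\<Sum>p\<le>K. c ^ (K - p) / fact (K - p) *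
      (of_nat (n1 * kdelta i2 0 + 1) * (of_int (- int n1 - 1 - int (kdelta i2 0)) gchoose m2) * of_nat (p choose m1)) * (s ^ p / fact p))
       * (t ^ n2 / fact n2)) (A ** B)"
    by (simp only: additive.sum[OF additive_lam] lam_single e1 ev_RA_scale elt_def ev_single)
      (simp add: sum_distrib_left sum_distrib_right cmat_sum_left mult_ac)
  also have "\<dots> = cmat (of_nat (kdelta i2 j1) * (s ^ m1 * (- c - s) ^ m2 / (fact m1 * fact m2) * (s + c) ^ kdelta i2 0 * ((s + c) ^ n1 / fact n1))
       * (t ^ n2 / fact n2)) (A ** B)"
    unfolding K_def half_product_genfun[OF k1(1)] ..
  also have "\<dots> = cmat (s ^ m1 * (- c - s) ^ m2 / (fact m1 * fact m2)) A ** twist (s + c) **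
      cmat ((s + c) ^ n1 * t ^ n2 / (fact n1 * fact n2)) B"
    by (simp add: twist_mult[OF assms] mult_ac)
  finally have 1: "lam c s t (\<Sum>p \<le> K.
        Poly_Mapping.single (int p - int m1 - int m2 - int n1 - 1 - int (kdelta i2 0))
          (RA_scale
            (of_nat (kdelta i2 j1) * of_nat (n1 * kdelta i2 0 + 1)
              * (of_int (- int n1 - 1 - int (kdelta i2 0)) gchoose m2) * of_nat (p choose m1))
            (elt (A ** B) i1 j2 p n2))) = \<dots>" .
  have "lam c s t (\<Sum>q \<le> L.
        Poly_Mapping.single (int q - int m1 - int m2 - int n2 - 1 - int (kdelta i1 0))
          (RA_scale
            (?e * of_nat (kdelta i1 j2)
              * (of_nat (kdelta i1 1) - of_nat ((n2 + 1) * kdelta i1 0))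
              * (of_int (- int n2 - 1 - int (kdelta i1 0)) gchoose m1) * of_nat (q choose m2))
            (elt (B ** A) j1 i2 n1 q)))
    = cmat (?e * of_nat (kdelta i1 j2) * (- 1) ^ kdelta i1 0 * (\<Sum>p\<le>L. c ^ (L - p) / fact (L - p) *
      (of_nat (n2 * kdelta i1 0 + 1) * (of_int (- int n2 - 1 - int (kdelta i1 0)) gchoose m1) * of_nat (p choose m2)) * (t ^ p / fact p))
       * (s ^ n1 / fact n1)) (B ** A)"
    unfolding sg
    by (simp only: additive.sum[OF additive_lam] lam_single e2 ev_RA_scale elt_def ev_single)
      (simp add: sum_distrib_left sum_distrib_right cmat_sum_left mult_ac)
  also have "\<dots> = cmat (?e * of_nat (kdelta i1 j2) * (- 1) ^ kdelta i1 0 *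
      (t ^ m2 * (- c - t) ^ m1 / (fact m2 * fact m1) * (t + c) ^ kdelta i1 0 * ((t + c) ^ n2 / fact n2))
       * (s ^ n1 / fact n1)) (B ** A)"
    unfolding L_def add.commute[of m1 m2] half_product_genfun[OF k1(2)] ..
  also have "\<dots> = cmat ?e (cmat (s ^ n1 * (t + c) ^ n2 / (fact n1 * fact n2)) B ** twist (- (t + c)) **
      cmat ((- c - t) ^ m1 * t ^ m2 / (fact m1 * fact m2)) A)"
  proof (cases "i1 = j2")
    case True
    have "(- (t + c)) ^ kdelta i1 0 = (- 1) ^ kdelta i1 0 * (t + c) ^ kdelta i1 0"
      by (rule power_minus)
    moreover have "kdelta j2 j2 = 1"
      by (simp add: kdelta_def)
    ultimately show ?thesis
      by (simp only: twist_mult[OF assms(2,1)] cmat_matrix_mult cmat_simps True of_nat_1 mult_1_left mult_1_right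
          times_divide_eq_left times_divide_eq_right divide_divide_eq_left mult_ac)
  next
    case False
    thus ?thesis
      by (simp add: twist_mult[OF assms(2,1)] block_mult_eq_0[OF assms(2,1)])
  qed
  finally have 2: "lam c s t (\<Sum>q \<le> L.
        Poly_Mapping.single (int q - int m1 - int m2 - int n2 - 1 - int (kdelta i1 0))
          (RA_scale
            (?e * of_nat (kdelta i1 j2)
              * (of_nat (kdelta i1 1) - of_nat ((n2 + 1) * kdelta i1 0))
              * (of_int (- int n2 - 1 - int (kdelta i1 0)) gchoose m1) * of_nat (q choose m2))
            (elt (B ** A) j1 i2 n1 q))) = \<dots>" .
  show ?thesis
    unfolding RA_Y_elt.simps additive.diff[OF additive_lam] super_bracket_def ev_single
      K_def[symmetric] L_def[symmetric] 1 2 by (simp add: mult.commute)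
qed

section \<open>Bilinearity, coefficients and closure of the product\<close>

lemma additive_RA_Y_elt_left: "Modules.additive (\<lambda>A. RA_Y_elt A a B b)"
  by (cases a; cases b)
    (auto intro!: additive.intro simp: matrix_mult_simps additive.add[OF additive_elt] RA.scale_right_distrib
      single_add sum.distrib)

lemma additive_RA_Y_elt_right: "Modules.additive (\<lambda>B. RA_Y_elt A a B b)"
  by (cases a; cases b)
    (auto intro!: additive.intro simp: matrix_mult_simps additive.add[OF additive_elt] RA.scale_right_distrib
      single_add sum.distrib)

lemma RA_Y_eq_psum: "RA_Y x y = psum (\<lambda>a A. psum (\<lambda>b B. RA_Y_elt A a B b) y) x"
  by (simp add: RA_Y_def psum_def)

lemma additive_RA_Y_left: "Modules.additive (\<lambda>x. RA_Y x y)"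
  unfolding RA_Y_eq_psum by (intro additive_psum additive_psum_param additive_RA_Y_elt_left)

lemma additive_RA_Y_right: "Modules.additive (\<lambda>y. RA_Y x y)"
  unfolding RA_Y_eq_psum by (intro additive_psum additive_psum_param additive_RA_Y_elt_right)

lemma lookup_RA_Y:
  "Poly_Mapping.lookup (RA_Y x y) e = psum (\<lambda>a A. psum (\<lambda>b B. Poly_Mapping.lookup (RA_Y_elt A a B b) e) y) x"
  by (simp add: RA_Y_eq_psum additive_psum_apply[OF additive_lookup])

lemma lookup_sum_singles:
  fixes g :: "nat \<Rightarrow> 'b::ab_group_add"
  assumes "\<And>p. f p = int p - int K - 1"
  shows "Poly_Mapping.lookup (\<Sum>p\<le>K. Poly_Mapping.single (f p) (g p)) e
    = (if e < 0 \<and> nat (- e - 1) \<le> K then g (K - nat (- e - 1)) else 0)"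
proof -
  have "Poly_Mapping.lookup (\<Sum>p\<le>K. Poly_Mapping.single (f p) (g p)) e
    = (\<Sum>p\<le>K. if f p = e then g p else 0)"
    by (simp add: additive.sum[OF additive_lookup] lookup_single when_def)
  also have "\<dots> = (\<Sum>p\<le>K. if p = K - nat (- e - 1) \<and> e < 0 \<and> nat (- e - 1) \<le> K then g p else 0)"
    by (intro sum.cong refl) (auto simp: assms)
  also have "\<dots> = (if e < 0 \<and> nat (- e - 1) \<le> K then g (K - nat (- e - 1)) else 0)"
    by auto
  finally show ?thesis .
qed

lemma lookup_RA_Y_elt:
  "Poly_Mapping.lookup (RA_Y_elt u (i1, i2, m1, m2) v (j1, j2, n1, n2)) e =
    (let K = m1 + m2 + n1 + kdelta i2 0; L = m1 + m2 + n2 + kdelta i1 0; N = nat (- e - 1);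
         p = K - N; q = L - N in
     (if e < 0 \<and> N \<le> K then RA_scale
       (of_nat (kdelta i2 j1) * of_nat (n1 * kdelta i2 0 + 1)
              * (of_int (- int n1 - 1 - int (kdelta i2 0)) gchoose m2) * of_nat (p choose m1))
            (elt (u ** v) i1 j2 p n2) else 0)
    - (if e < 0 \<and> N \<le> L then RA_scale
            (koszul_sign (i1 + i2) (j1 + j2) * of_nat (kdelta i1 j2)
              * (of_nat (kdelta i1 1) - of_nat ((n2 + 1) * kdelta i1 0))
              * (of_int (- int n2 - 1 - int (kdelta i1 0)) gchoose m1) * of_nat (q choose m2))
            (elt (v ** u) j1 i2 n1 q) else 0))"
  unfolding RA_Y_elt.simps lookup_minus Let_def
  by (subst (1 2) lookup_sum_singles) simp_all

lemma RA_Y_elt_cmat: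
  "Poly_Mapping.lookup (RA_Y_elt (cmat c A) a B b) e = RA_scale c (Poly_Mapping.lookup (RA_Y_elt A a B b) e)"
  "Poly_Mapping.lookup (RA_Y_elt A a (cmat c B) b) e = RA_scale c (Poly_Mapping.lookup (RA_Y_elt A a B b) e)"
  by (cases a; cases b; simp add: lookup_RA_Y_elt Let_def RA_scale_elt RA.scale_right_diff_distrib mult_ac
      del: RA_Y_elt.simps)+

lemma RA_Y_scale_left: "Poly_Mapping.lookup (RA_Y (RA_scale c x) y) e = RA_scale c (Poly_Mapping.lookup (RA_Y x y) e)"
  unfolding lookup_RA_Y
proof (rule psum_RA_scale)
  show "psum (\<lambda>b B. Poly_Mapping.lookup (RA_Y_elt (cmat c A) a B b) e) y
    = RA_scale c (psum (\<lambda>b B. Poly_Mapping.lookup (RA_Y_elt A a B b) e) y)" for a A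
    by (simp add: RA_Y_elt_cmat additive_psum_apply[OF additive_RA_scale])
qed (intro additive_psum_param additive_compose[OF additive_lookup] additive_RA_Y_elt_left additive_RA_scale)+

lemma RA_Y_scale_right: "Poly_Mapping.lookup (RA_Y x (RA_scale c y)) e = RA_scale c (Poly_Mapping.lookup (RA_Y x y) e)"
proof -
  have "psum (\<lambda>b B. Poly_Mapping.lookup (RA_Y_elt A a B b) e) (RA_scale c y)
    = RA_scale c (psum (\<lambda>b B. Poly_Mapping.lookup (RA_Y_elt A a B b) e) y)" for A a
    by (rule psum_RA_scale) (auto simp: RA_Y_elt_cmat
      intro: additive_compose[OF additive_lookup] additive_RA_Y_elt_right additive_RA_scale)
  thus ?thesis
    by (simp add: lookup_RA_Y additive_psum_apply[OF additive_RA_scale])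
qed

lemma keys_RA_Y: "Poly_Mapping.keys (RA_Y x y) \<subseteq> {..<0}"
proof
  fix e assume e: "e \<in> Poly_Mapping.keys (RA_Y x y)"
  have "Poly_Mapping.lookup (RA_Y x y) e = 0" if "\<not> e < 0"
    unfolding lookup_RA_Y psum_def
  proof (intro sum.neutral ballI)
    fix a b
    show "Poly_Mapping.lookup (RA_Y_elt (Poly_Mapping.lookup x a) a (Poly_Mapping.lookup y b) b) e = 0"
      using that by (cases a; cases b) (simp add: lookup_RA_Y_elt del: RA_Y_elt.simps)
  qed
  with e show "e \<in> {..<0}"
    by (auto simp: in_keys_iff)
qed

text \<open>The first half keeps the second exponent n2 >= l. The second half has second exponent q
  and the factor binom(q, m2), which vanishes unless q >= m2 >= l; this is why truncation at a power
  of t_2 is compatible with the product.\<close>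

lemma RA_Y_closed:
  assumes x: "x \<in> homog l i" and y: "y \<in> homog l j"
  shows "Poly_Mapping.lookup (RA_Y x y) e \<in> homog l (i + j)"
  unfolding lookup_RA_Y psum_def
proof (intro RA.subspace_sum[OF subspace_homog])
  fix a b assume a: "a \<in> Poly_Mapping.keys x" and b: "b \<in> Poly_Mapping.keys y"
  obtain i1 i2 m1 m2 where a': "a = (i1, i2, m1, m2)" by (cases a) auto
  obtain j1 j2 n1 n2 where b': "b = (j1, j2, n1, n2)" by (cases b) auto
  define A B where "A = Poly_Mapping.lookup x a" and "B = Poly_Mapping.lookup y b"
  have A: "block A i1 i2" "i1 + i2 = i" "l \<le> m2"
    using x a unfolding homog_def A_def a' by (auto simp: in_keys_iff)
  have B: "block B j1 j2" "j1 + j2 = j" "l \<le> n2"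
    using y b unfolding homog_def B_def b' by (auto simp: in_keys_iff)
  have 1: "RA_scale (of_nat (kdelta i2 j1) * k * k' * k'') (elt (A ** B) i1 j2 p n2) \<in> homog l (i + j)" for k k' k'' p
  proof (cases "i2 = j1")
    case True
    have "i1 + j2 = i + j"
      using A(2) B(2) True by (auto simp: add_ac)
    thus ?thesis
      unfolding elt_def using block_mult[OF A(1) B(1)] B(3)
      by (intro RA.subspace_scale[OF subspace_homog] single_in_homog)
  qed (simp add: kdelta_def RA.subspace_0[OF subspace_homog])
  have 2: "RA_scale (k * of_nat (kdelta i1 j2) * k' * k'' * of_nat (q choose m2)) (elt (B ** A) j1 i2 n1 q) \<in> homog l (i + j)" for k k' k'' q
  proof (cases "i1 = j2 \<and> m2 \<le> q")
    case True
    hence "j1 + i2 = i + j" "l \<le> q"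
      using A(2,3) B(2) by (auto simp: add_ac)
    thus ?thesis
      unfolding elt_def using block_mult[OF B(1) A(1)]
      by (intro RA.subspace_scale[OF subspace_homog] single_in_homog)
  qed (auto simp: kdelta_def binomial_eq_0 not_le RA.subspace_0[OF subspace_homog])
  have "Poly_Mapping.lookup (RA_Y_elt A a B b) e \<in> homog l (i + j)"
    unfolding a' b' lookup_RA_Y_elt Let_def
    by (intro RA.subspace_diff[OF subspace_homog]) (auto intro: 1 2 simp only: RA.subspace_0[OF subspace_homog] split: if_splits)
  thus "Poly_Mapping.lookup (RA_Y_elt (Poly_Mapping.lookup x a) a (Poly_Mapping.lookup y b) b) e \<in> homog l (i + j)"
    by (simp add: A_def B_def)
qed

text \<open>Both sides are biadditive, so singles suffice. Homogeneity makes one sign valid for all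
  pairs of labels, and the block conditions allow \<open>lam_RA_Y_elt\<close>.\<close>

lemma lam_RA_Y:
  fixes x y :: "('a::field_char_0, 'm::finite, 'n::finite) RA"
  assumes x: "x \<in> homog l i" and y: "y \<in> homog l j"
  shows "lam c s t (RA_Y x y) = super_bracket (koszul_sign i j) c s t (\<lambda>s t. ev s t x) (\<lambda>s t. ev s t y)"
proof -
  define F where "F x y = super_bracket (koszul_sign i j) c s t (\<lambda>s t. ev s t x) (\<lambda>s t. ev s t y)"
    for x y :: "('a, 'm, 'n) RA"
  have aF: "Modules.additive (\<lambda>x. F x y)" for y
    unfolding F_def super_bracket_def
    by standard (simp add: additive.add[OF additive_ev] matrix_mult_simps cmat_add)
  have aF': "Modules.additive (F x)" for x
    unfolding F_def super_bracket_def
    by standard (simp add: additive.add[OF additive_ev] matrix_mult_simps cmat_add)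
  have "lam c s t (RA_Y x y) = psum (\<lambda>a A. psum (\<lambda>b B. lam c s t (RA_Y_elt A a B b)) y) x"
    by (simp add: RA_Y_eq_psum additive_psum_apply[OF additive_lam])
  also have "\<dots> = psum (\<lambda>a A. psum (\<lambda>b B. F (Poly_Mapping.single a A) (Poly_Mapping.single b B)) y) x"
    unfolding psum_def
  proof (intro sum.cong refl)
    fix a b assume a: "a \<in> Poly_Mapping.keys x" and b: "b \<in> Poly_Mapping.keys y"
    obtain i1 i2 m1 m2 where a': "a = (i1, i2, m1, m2)" by (cases a) auto
    obtain j1 j2 n1 n2 where b': "b = (j1, j2, n1, n2)" by (cases b) auto
    define A B where "A = Poly_Mapping.lookup x a" and "B = Poly_Mapping.lookup y b"
    have A: "block A i1 i2" "i1 + i2 = i"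
      using x a unfolding homog_def A_def a' by (auto simp: in_keys_iff)
    have B: "block B j1 j2" "j1 + j2 = j"
      using y b unfolding homog_def B_def b' by (auto simp: in_keys_iff)
    have "lam c s t (RA_Y_elt A (i1, i2, m1, m2) B (j1, j2, n1, n2))
      = F (Poly_Mapping.single (i1, i2, m1, m2) A) (Poly_Mapping.single (j1, j2, n1, n2) B)"
      unfolding F_def lam_RA_Y_elt[OF A(1) B(1)] A(2) B(2) ..
    thus "lam c s t (RA_Y_elt (Poly_Mapping.lookup x a) a (Poly_Mapping.lookup y b) b)
      = F (Poly_Mapping.single a (Poly_Mapping.lookup x a)) (Poly_Mapping.single b (Poly_Mapping.lookup y b))"
      unfolding A_def B_def a'[symmetric] b'[symmetric] .
  qed
  also have "\<dots> = F (psum Poly_Mapping.single x) (psum Poly_Mapping.single y)"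
    by (subst additive_psum_apply[OF aF]) (simp only: additive_psum_apply[OF aF'])
  also have "\<dots> = F x y"
    by (simp flip: poly_mapping_eq_psum)
  finally show ?thesis
    by (simp only: F_def)
qed

section \<open>Recovering elements and modes from evaluations\<close>

lemma block_nth_eq_0: "block A i j \<Longrightarrow> lab p \<noteq> i \<or> lab q \<noteq> j \<Longrightarrow> A $ p $ q = 0"
  unfolding block_def by blast

text \<open>\<open>ev\<close> forgets the labels, but in an aligned element the entry (p, q) is
  nonzero only under the labels (lab p, lab q), so different summands do not mix.\<close>

lemma ev_nth:
  assumes x: "x \<in> aligned l" and K: "\<And>i j m n. (i, j, m, n) \<in> Poly_Mapping.keys x \<Longrightarrow> m \<le> K \<and> n \<le> K"
  shows "ev s t x $ p $ q = (\<Sum>m\<le>K. \<Sum>n\<le>K. s ^ m * t ^ n *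
    (Poly_Mapping.lookup x (lab p, lab q, m, n) $ p $ q / (fact m * fact n)))"
proof -
  let ?B = "(\<lambda>(m, n). (lab p, lab q, m, n)) ` ({..K} \<times> {..K})"
  have "ev s t x $ p $ q = (\<Sum>a\<in>Poly_Mapping.keys x.
     (case a of (i, j, m, n) \<Rightarrow> s ^ m * t ^ n / (fact m * fact n) * Poly_Mapping.lookup x a $ p $ q))"
    unfolding ev_def psum_def sum_component by (intro sum.cong refl) (auto split: prod.split)
  also have "\<dots> = (\<Sum>a\<in>?B.
     (case a of (i, j, m, n) \<Rightarrow> s ^ m * t ^ n / (fact m * fact n) * Poly_Mapping.lookup x a $ p $ q))"
  proof (rule sum.mono_neutral_cong)
    fix a assume "a \<in> Poly_Mapping.keys x - ?B"
    moreover obtain i j m n where a: "a = (i, j, m, n)" by (cases a) auto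
    ultimately have "i \<noteq> lab p \<or> j \<noteq> lab q"
      using K by (force simp: image_iff)
    moreover have "block (Poly_Mapping.lookup x (i, j, m, n)) i j"
      using x by (simp add: aligned_def)
    ultimately have "Poly_Mapping.lookup x (i, j, m, n) $ p $ q = 0"
      by (intro block_nth_eq_0) auto
    thus "(case a of (i, j, m, n) \<Rightarrow> s ^ m * t ^ n / (fact m * fact n) * Poly_Mapping.lookup x a $ p $ q) = 0"
      by (simp add: a)
  qed (auto simp: in_keys_iff)
  also have "\<dots> = (\<Sum>(m, n)\<in>{..K} \<times> {..K}. s ^ m * t ^ n *
    (Poly_Mapping.lookup x (lab p, lab q, m, n) $ p $ q / (fact m * fact n)))"
    by (subst sum.reindex) (auto simp: inj_on_def intro!: sum.cong)
  finally show ?thesis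
    by (simp add: sum.cartesian_product)
qed

lemma ev_eq_0_imp:
  assumes x: "x \<in> aligned l" and z: "\<And>s t. ev s t x = 0"
  shows "x = 0"
proof (rule poly_mapping_eqI)
  fix a :: "bit \<times> bit \<times> nat \<times> nat"
  obtain i j m n where a: "a = (i, j, m, n)" by (cases a) auto
  \<comment> \<open>The target exponents m and n enter the maximum because they may lie outside the
    support.\<close>
  define K where "K = Max (insert (max m n) ((\<lambda>(i, j, m, n). max m n) ` Poly_Mapping.keys x))"
  have le: "max m' n' \<le> K" if "(i', j', m', n') \<in> Poly_Mapping.keys x" for i' j' m' n'
    unfolding K_def by (rule Max_ge) (use that in force)+
  have "max m n \<le> K"
    unfolding K_def by (rule Max_ge) auto
  have "Poly_Mapping.lookup x (i, j, m, n) $ p $ q = 0" for p q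
  proof (cases "lab p = i \<and> lab q = j")
    case True
    have "Poly_Mapping.lookup x (lab p, lab q, m, n) $ p $ q / (fact m * fact n) = 0"
    proof (rule polyfun2_coeff_eq[where K = K])
      fix s t
      have "ev s t x $ p $ q = 0"
        by (simp add: z)
      thus "(\<Sum>m\<le>K. \<Sum>n\<le>K. s ^ m * t ^ n *
          (Poly_Mapping.lookup x (lab p, lab q, m, n) $ p $ q / (fact m * fact n)))
         = (\<Sum>m\<le>K. \<Sum>n\<le>K. s ^ m * t ^ n * 0)"
        by (subst (asm) ev_nth[OF x, where K = K]) (use le in auto)
    qed (use \<open>max m n \<le> K\<close> in auto)
    with True show ?thesis by simp
  next
    case False
    moreover have "block (Poly_Mapping.lookup x (i, j, m, n)) i j"
      using x by (simp add: aligned_def)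
    ultimately show ?thesis by (intro block_nth_eq_0) auto
  qed
  thus "Poly_Mapping.lookup x a = Poly_Mapping.lookup 0 a"
    by (simp add: a vec_eq_iff)
qed

lemma ev_inject:
  assumes "x \<in> aligned l" "y \<in> aligned l" "\<And>s t. ev s t x = ev s t y"
  shows "x = y"
proof -
  have "x - y = 0"
    by (rule ev_eq_0_imp[OF RA.subspace_diff[OF subspace_aligned assms(1,2)]])
      (simp add: additive.diff[OF additive_ev] assms(3))
  thus ?thesis by simp
qed

text \<open>Comparing coefficients of c at fixed s, t reduces the claim to \<open>ev_inject\<close>.
  This and the two-variable version turn bracket identities back into identities of modes.\<close>

lemma genfun_inject:
  assumes "\<And>N. f N \<in> aligned l" "\<And>N. g N \<in> aligned l"
    and eq: "\<And>c s t. (\<Sum>N\<le>K. cmat (c ^ N / fact N) (ev s t (f N))) = (\<Sum>N\<le>K. cmat (c ^ N / fact N) (ev s t (g N)))"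
    and "N \<le> K"
  shows "f N = g N"
proof (rule ev_inject[OF assms(1,2)])
  fix s t
  have "ev s t (f N) $ p $ q / fact N = ev s t (g N) $ p $ q / fact N" for p q
  proof (rule polyfun_coeff_eq[where K = K])
    fix c
    from arg_cong[OF eq[of c s t], of "\<lambda>A. A $ p $ q"]
    show "(\<Sum>N\<le>K. c ^ N * (ev s t (f N) $ p $ q / fact N)) = (\<Sum>N\<le>K. c ^ N * (ev s t (g N) $ p $ q / fact N))"
      by (simp add: sum_component)
  qed fact
  thus "ev s t (f N) = ev s t (g N)"
    by (simp add: vec_eq_iff)
qed

lemma genfun2_inject:
  assumes "\<And>m n. f m n \<in> aligned l" "\<And>m n. g m n \<in> aligned l"
    and eq: "\<And>c d s t. (\<Sum>m\<le>K. \<Sum>n\<le>K. cmat (c ^ m / fact m * (d ^ n / fact n)) (ev s t (f m n)))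
      = (\<Sum>m\<le>K. \<Sum>n\<le>K. cmat (c ^ m / fact m * (d ^ n / fact n)) (ev s t (g m n)))"
    and "m \<le> K" "n \<le> K"
  shows "f m n = g m n"
proof (rule ev_inject[OF assms(1,2)])
  fix s t
  have "ev s t (f m n) $ p $ q / (fact m * fact n) = ev s t (g m n) $ p $ q / (fact m * fact n)" for p q
  proof (rule polyfun2_coeff_eq[where K = K])
    fix c d
    from arg_cong[OF eq[of c d s t], of "\<lambda>A. A $ p $ q"]
    show "(\<Sum>m\<le>K. \<Sum>n\<le>K. c ^ m * d ^ n * (ev s t (f m n) $ p $ q / (fact m * fact n)))
      = (\<Sum>m\<le>K. \<Sum>n\<le>K. c ^ m * d ^ n * (ev s t (g m n) $ p $ q / (fact m * fact n)))"
      by (simp add: sum_component)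
  qed fact+
  thus "ev s t (f m n) = ev s t (g m n)"
    by (simp add: vec_eq_iff)
qed

subsection \<open>Modes and the derivation\<close>

lemma eventually_mode_eq_0: "\<exists>K. \<forall>N>K. mode Y N x y = 0"
proof -
  let ?A = "(\<lambda>e. nat (- e - 1)) ` Poly_Mapping.keys (Y x y)"
  have "mode Y N x y = 0" if "N > Max (insert 0 ?A)" for N
  proof (rule ccontr)
    assume "mode Y N x y \<noteq> 0"
    hence "- int N - 1 \<in> Poly_Mapping.keys (Y x y)"
      by (simp add: mode_def in_keys_iff)
    hence "N \<in> ?A" by force
    hence "N \<le> Max (insert 0 ?A)" by (intro Max_ge) auto
    with that show False by (meson leD)
  qed
  thus ?thesis by blast
qed

text \<open>K may be any bound on the nonzero modes; this freedom lets several generating functions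
  share one summation range.\<close>

lemma lam_eq_sum_modes:
  assumes "\<And>N. N > K \<Longrightarrow> mode RA_Y N x y = 0"
  shows "lam c s t (RA_Y x y) = (\<Sum>N\<le>K. cmat (c ^ N / fact N) (ev s t (mode RA_Y N x y)))"
proof -
  let ?A = "(\<lambda>N. - int N - 1) ` {..K}"
  have "Poly_Mapping.keys (RA_Y x y) \<subseteq> ?A"
  proof
    fix e assume e: "e \<in> Poly_Mapping.keys (RA_Y x y)"
    with keys_RA_Y have "e < 0" by blast
    hence e': "e = - int (nat (- e - 1)) - 1" by simp
    with e have "mode RA_Y (nat (- e - 1)) x y \<noteq> 0"
      by (simp add: mode_def in_keys_iff)
    hence "nat (- e - 1) \<le> K"
      using assms by (metis not_le)
    with e' show "e \<in> ?A" by blast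
  qed
  hence "lam c s t (RA_Y x y) = (\<Sum>e\<in>?A. cmat (c ^ nat (- e - 1) / fact (nat (- e - 1))) (ev s t (Poly_Mapping.lookup (RA_Y x y) e)))"
    unfolding lam_def by (intro psum_superset) (auto simp: additive.zero[OF additive_ev])
  also have "\<dots> = (\<Sum>N\<le>K. cmat (c ^ N / fact N) (ev s t (mode RA_Y N x y)))"
    by (subst sum.reindex) (auto simp: inj_on_def mode_def)
  finally show ?thesis .
qed

lemma mode_closed: "x \<in> homog l i \<Longrightarrow> y \<in> homog l j \<Longrightarrow> mode RA_Y n x y \<in> homog l (i + j)"
  unfolding mode_def by (rule RA_Y_closed)

lemma additive_mode_left: "Modules.additive (\<lambda>x. mode RA_Y n x y)"
  unfolding mode_def by (rule additive_compose[OF additive_lookup additive_RA_Y_left])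

lemma additive_mode_right: "Modules.additive (\<lambda>y. mode RA_Y n x y)"
  unfolding mode_def by (rule additive_compose[OF additive_lookup additive_RA_Y_right])

lemma mode_scale:
  "mode RA_Y n (RA_scale c x) y = RA_scale c (mode RA_Y n x y)"
  "mode RA_Y n x (RA_scale c y) = RA_scale c (mode RA_Y n x y)"
  by (simp_all add: mode_def RA_Y_scale_left RA_Y_scale_right)

lemma mode_sum_scale:
  "mode RA_Y n (\<Sum>i\<in>I. RA_scale (f i) (x i)) y = (\<Sum>i\<in>I. RA_scale (f i) (mode RA_Y n (x i) y))"
  "mode RA_Y n x' (\<Sum>i\<in>I. RA_scale (f i) (y' i)) = (\<Sum>i\<in>I. RA_scale (f i) (mode RA_Y n x' (y' i)))"
  by (simp_all add: additive.sum[OF additive_mode_left] additive.sum[OF additive_mode_right] mode_scale)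

lemma RA_deriv_eq_psum:
  "RA_deriv = psum (\<lambda>(i, j, m, n) A. RA_scale (of_nat (m + 1)) (elt A i j (m + 1) n) +
     RA_scale (of_nat (n + 1)) (elt A i j m (n + 1)))"
  by (rule ext) (auto simp: RA_deriv_def psum_def intro!: sum.cong)

lemma additive_RA_deriv: "Modules.additive RA_deriv"
  unfolding RA_deriv_eq_psum
  by (rule additive_psum)
    (auto intro!: additive.intro simp: additive.add[OF additive_elt] RA.scale_right_distrib split: prod.split)

lemma RA_deriv_scale: "RA_deriv (RA_scale c x) = RA_scale c (RA_deriv x)"
  unfolding RA_deriv_eq_psum
  by (rule psum_RA_scale)
    (auto intro!: additive.intro simp: additive.add[OF additive_elt] RA.scale_right_distrib RA_scale_elt cmat_add mult.commute
      split: prod.split)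

lemma RA_deriv_closed:
  assumes x: "x \<in> homog l i" shows "RA_deriv x \<in> homog l i"
  unfolding RA_deriv_eq_psum psum_def
proof (intro RA.subspace_sum[OF subspace_homog])
  fix a assume a: "a \<in> Poly_Mapping.keys x"
  obtain i1 i2 m n where a': "a = (i1, i2, m, n)" by (cases a) auto
  have "block (Poly_Mapping.lookup x a) i1 i2" "i1 + i2 = i" "l \<le> n"
    using x a unfolding homog_def a' by (auto simp: in_keys_iff)
  thus "(case a of (i, j, m, n) \<Rightarrow> \<lambda>A. RA_scale (of_nat (m + 1)) (elt A i j (m + 1) n) +
     RA_scale (of_nat (n + 1)) (elt A i j m (n + 1))) (Poly_Mapping.lookup x a) \<in> homog l i"
    by (auto simp: a' elt_def intro!: RA.subspace_add[OF subspace_homog] RA.subspace_scale[OF subspace_homog] single_in_homog)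
qed

lemma ev_RA_deriv:
  fixes s t :: "'a::field_char_0"
  shows "ev s t (RA_deriv x) = cmat (s + t) (ev s t x)"
proof -
  have "ev s t (RA_deriv x) = psum (\<lambda>a A. cmat (s + t) (ev s t (Poly_Mapping.single a A))) x"
    unfolding RA_deriv_eq_psum additive_psum_apply[OF additive_ev]
    unfolding psum_def
  proof (intro sum.cong refl)
    fix a :: "bit \<times> bit \<times> nat \<times> nat"
    obtain i j m n where a: "a = (i, j, m, n)" by (cases a) auto
    have *: "of_nat (k + 1) * (r / fact (k + 1)) = (r / fact k :: 'a)" for k r
      by (simp add: fact_Suc del: of_nat_Suc)
    have "of_nat (m + 1) * (s ^ (m + 1) * t ^ n / (fact (m + 1) * fact n)) + of_nat (n + 1) * (s ^ m * t ^ (n + 1) / (fact m * fact (n + 1)))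
      = of_nat (m + 1) * (s ^ (m + 1) / fact (m + 1)) * (t ^ n / fact n) + of_nat (n + 1) * (t ^ (n + 1) / fact (n + 1)) * (s ^ m / fact m)"
      by (simp only: times_divide_times_eq times_divide_eq_right times_divide_eq_left divide_divide_eq_left mult_ac)
    also have "\<dots> = (s + t) * (s ^ m * t ^ n / (fact m * fact n))"
      unfolding * by (simp add: field_simps)
    finally have "of_nat (m + 1) * (s ^ (m + 1) * t ^ n / (fact (m + 1) * fact n)) + of_nat (n + 1) * (s ^ m * t ^ (n + 1) / (fact m * fact (n + 1)))
      = (s + t) * (s ^ m * t ^ n / (fact m * fact n))" .
    thus "ev s t ((case a of (i, j, m, n) \<Rightarrow> \<lambda>A. RA_scale (of_nat (m + 1)) (elt A i j (m + 1) n) +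
       RA_scale (of_nat (n + 1)) (elt A i j m (n + 1))) (Poly_Mapping.lookup x a))
      = cmat (s + t) (ev s t (Poly_Mapping.single a (Poly_Mapping.lookup x a)))"
      by (simp add: a additive.add[OF additive_ev] ev_RA_scale elt_def ev_single flip: cmat_add_left del: of_nat_Suc fact_Suc)
  qed
  also have "\<dots> = cmat (s + t) (ev s t (psum Poly_Mapping.single x))"
    by (rule additive_psum_apply[symmetric]) (rule additive_compose[OF additive_cmat additive_ev])
  finally show ?thesis
    by (simp flip: poly_mapping_eq_psum)
qed

subsection \<open>The axioms of a conformal superalgebra\<close>

lemma sum_square_triangle:
  fixes f :: "nat \<Rightarrow> nat \<Rightarrow> 'a::comm_monoid_add"
  assumes "\<And>i j. i + j > K \<Longrightarrow> f i j = 0"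
  shows "(\<Sum>i\<le>K. \<Sum>j\<le>K. f i j) = (\<Sum>k\<le>K. \<Sum>i\<le>k. f i (k - i))"
proof -
  have "(\<Sum>i\<le>K. \<Sum>j\<le>K. f i j) = (\<Sum>(i, j)\<in>{..K} \<times> {..K}. f i j)"
    by (rule sum.cartesian_product)
  also have "\<dots> = (\<Sum>(i, j)\<in>{(i, j). i + j \<le> K}. f i j)"
  proof (rule sum.mono_neutral_right)
    have "i + j \<le> K" if "f i j \<noteq> 0" for i j
      using assms that by (meson not_le)
    thus "\<forall>x\<in>{..K} \<times> {..K} - {(i, j). i + j \<le> K}. (case x of (i, j) \<Rightarrow> f i j) = 0"
      by auto
  qed auto
  also have "\<dots> = (\<Sum>k\<le>K. \<Sum>i\<le>k. f i (k - i))"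
    by (rule sum.triangle_reindex_eq)
  finally show ?thesis .
qed

lemma binomial_fact_sum:
  fixes c d :: "'a::field_char_0"
  shows "(c + d) ^ N / fact N = (\<Sum>n\<le>N. c ^ n / fact n * (d ^ (N - n) / fact (N - n)))"
proof -
  have "(c + d) ^ N / fact N = (\<Sum>n\<le>N. of_nat (N choose n) * c ^ n * d ^ (N - n) / fact N)"
    by (simp only: binomial_ring sum_divide_distrib)
  also have "\<dots> = (\<Sum>n\<le>N. c ^ n / fact n * (d ^ (N - n) / fact (N - n)))"
    by (intro sum.cong refl) (simp add: binomial_fact)
  finally show ?thesis .
qed

text \<open>Here d stands for the scalar by which the derivation acts under \<open>ev\<close>.
  Collecting the terms with n + k = N leaves the sign (-1)^(N+1) and the binomial expansion of (c +
  d)^N: the bracket at -c-d.\<close>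

lemma skew_symmetry_genfun:
  fixes a :: "nat \<Rightarrow> 'a::field_char_0"
  assumes "\<And>N. N > K \<Longrightarrow> a N = 0"
  shows "(\<Sum>n\<le>K. \<Sum>k\<le>K. c ^ n / fact n * ((- 1) ^ (n + k + 1) / fact k * (d ^ k * a (n + k))))
    = - (\<Sum>N\<le>K. (- c - d) ^ N / fact N * a N)"
proof -
  have "(\<Sum>n\<le>K. \<Sum>k\<le>K. c ^ n / fact n * ((- 1) ^ (n + k + 1) / fact k * (d ^ k * a (n + k))))
    = (\<Sum>N\<le>K. \<Sum>n\<le>N. c ^ n / fact n * ((- 1) ^ (n + (N - n) + 1) / fact (N - n) * (d ^ (N - n) * a (n + (N - n)))))"
    by (rule sum_square_triangle) (simp add: assms)
  also have "\<dots> = (\<Sum>N\<le>K. - ((- 1) ^ N * (\<Sum>n\<le>N. c ^ n / fact n * (d ^ (N - n) / fact (N - n)))) * a N)"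
    unfolding sum_distrib_left sum_distrib_right sum_negf[symmetric]
    by (intro sum.cong refl) simp
  also have "\<dots> = (\<Sum>N\<le>K. - ((- c - d) ^ N / fact N * a N))"
  proof (intro sum.cong refl)
    fix N
    have "(- c - d) ^ N = (- 1) ^ N * (c + d) ^ N"
      by (simp add: minus_diff_commute flip: power_mult_distrib)
    thus "- ((- 1) ^ N * (\<Sum>n\<le>N. c ^ n / fact n * (d ^ (N - n) / fact (N - n)))) * a N
      = - ((- c - d) ^ N / fact N * a N)"
      unfolding binomial_fact_sum[symmetric] by simp
  qed
  finally show ?thesis
    by (simp add: sum_negf)
qed

text \<open>Since binom(m, r) c^m / m! = (c^r / r!) (c^(m-r) / (m-r)!), putting j = m-r combines c^j
  and d^n into powers of c + d. With K1 + K2 <= K, each index pushed beyond the range has r > K1 or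
  j + n > K2, so the square sums may be rearranged.\<close>

lemma commutator_genfun:
  fixes a :: "nat \<Rightarrow> nat \<Rightarrow> 'a::field_char_0"
  assumes a: "\<And>r M. r > K1 \<or> M > K2 \<Longrightarrow> a r M = 0" and K: "K1 + K2 \<le> K"
  shows "(\<Sum>m\<le>K. \<Sum>n\<le>K. c ^ m / fact m * (d ^ n / fact n) * (\<Sum>r\<le>m. of_nat (m choose r) * a r (m + n - r)))
    = (\<Sum>r\<le>K. c ^ r / fact r * (\<Sum>M\<le>K. (c + d) ^ M / fact M * a r M))"
proof -
  define g where "g r j n = c ^ r / fact r * (c ^ j / fact j * (d ^ n / fact n) * a r (j + n))" for r j n
  have "(\<Sum>r\<le>K. c ^ r / fact r * (\<Sum>M\<le>K. (c + d) ^ M / fact M * a r M)) = (\<Sum>r\<le>K. \<Sum>j\<le>K. \<Sum>n\<le>K. g r j n)"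
  proof (intro sum.cong refl)
    fix r
    have "(\<Sum>j\<le>K. \<Sum>n\<le>K. g r j n) = (\<Sum>M\<le>K. \<Sum>j\<le>M. g r j (M - j))"
      by (rule sum_square_triangle) (use K in \<open>auto simp: g_def intro!: a\<close>)
    also have "\<dots> = (\<Sum>M\<le>K. c ^ r / fact r * ((c + d) ^ M / fact M * a r M))"
      unfolding binomial_fact_sum sum_distrib_left sum_distrib_right
      by (intro sum.cong refl) (simp add: g_def)
    finally show "c ^ r / fact r * (\<Sum>M\<le>K. (c + d) ^ M / fact M * a r M) = (\<Sum>j\<le>K. \<Sum>n\<le>K. g r j n)"
      by (simp add: sum_distrib_left)
  qed
  also have "\<dots> = (\<Sum>r\<le>K. \<Sum>n\<le>K. \<Sum>j\<le>K. g r j n)"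
    by (intro sum.cong refl sum.swap)
  also have "\<dots> = (\<Sum>n\<le>K. \<Sum>r\<le>K. \<Sum>j\<le>K. g r j n)"
    by (rule sum.swap)
  also have "\<dots> = (\<Sum>n\<le>K. \<Sum>m\<le>K. \<Sum>r\<le>m. g r (m - r) n)"
  proof (rule sum.cong[OF refl], rule sum_square_triangle)
    fix n r j assume "K < r + j"
    hence "r > K1 \<or> j + n > K2" using K by linarith
    thus "g r j n = 0" by (simp add: g_def a)
  qed
  also have "\<dots> = (\<Sum>m\<le>K. \<Sum>n\<le>K. \<Sum>r\<le>m. g r (m - r) n)"
    by (rule sum.swap)
  also have "\<dots> = (\<Sum>m\<le>K. \<Sum>n\<le>K. c ^ m / fact m * (d ^ n / fact n) * (\<Sum>r\<le>m. of_nat (m choose r) * a r (m + n - r)))"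
  proof (intro sum.cong refl)
    fix m n
    have "g r (m - r) n = c ^ m / fact m * (d ^ n / fact n) * (of_nat (m choose r) * a r (m + n - r))" if "r \<le> m" for r
    proof -
      have "c ^ m = c ^ r * c ^ (m - r)" "m - r + n = m + n - r"
        using that by (simp_all flip: power_add)
      moreover have "of_nat (m choose r) = (fact m / (fact r * fact (m - r)) :: 'a)"
        using that by (simp add: binomial_fact)
      ultimately show ?thesis
        by (simp add: g_def mult_ac)
    qed
    thus "(\<Sum>r\<le>m. g r (m - r) n) = c ^ m / fact m * (d ^ n / fact n) * (\<Sum>r\<le>m. of_nat (m choose r) * a r (m + n - r))"
      by (simp add: sum_distrib_left)
  qed
  finally show ?thesis ..
qed

text \<open>The substitution of -c-s-t for c sends s + c to -c-t and -c-s to t + c, which exchanges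
  the two summands.\<close>

lemma super_bracket_skew:
  "super_bracket e c s t U V = - cmat e (super_bracket e (- c - s - t) s t V U)" if "e * e = 1"
  for e c s t :: "'a::field_char_0"
  using that by (simp add: super_bracket_def cmat_diff algebra_simps)

definition "super_bracket' e c U V s t = super_bracket e c s t U V"

text \<open>The signs x, y, z belong to the pairs (U,V), (U,W), (V,W). Expanding the left side gives
  eight triple products; those in the orders U W V and V W U cancel because x * x = 1, and the other
  four are the right side.\<close>

lemma super_bracket_jacobi:
  fixes c d s t x y z :: "'a::field_char_0"
  assumes x: "x * x = 1"
  shows "super_bracket (x * y) c s t U (super_bracket' z d V W)
     - cmat x (super_bracket (x * z) d s t V (super_bracket' y c U W))
   = super_bracket (y * z) (c + d) s t (super_bracket' x c U V) W"
proof -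
  have [simp]: "- d - (c + r) = - c - (d + r)" "x * (x * r) = r" for r
    using x by (simp_all add: algebra_simps flip: mult.assoc)
  show ?thesis
    by (simp add: super_bracket_def super_bracket'_def cmat_add cmat_diff matrix_mult_simps matrix_mul_assoc algebra_simps)
qed

section \<open>From brackets of matrix functions to the axioms for modes\<close>

lemma koszul_sign_simps:
  "koszul_sign i (j + h) = (koszul_sign i j * koszul_sign i h :: 'a::comm_ring_1)"
  "koszul_sign (i + j) h = (koszul_sign i h * koszul_sign j h :: 'a::comm_ring_1)"
  "koszul_sign i j * koszul_sign i j = (1 :: 'a)"
  by (cases i; cases j; cases h; simp add: koszul_sign_def)+

lemma koszul_sign_commute: "koszul_sign i j = koszul_sign j i"
  by (auto simp: koszul_sign_def)

text \<open>The bracket at the scalar c as an element of the algebra, which can therefore be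
  inserted into a further mode.\<close>

definition genfun :: "nat \<Rightarrow> 'a::field_char_0 \<Rightarrow> ('a, 'm::finite, 'n::finite) RA \<Rightarrow> ('a, 'm, 'n) RA \<Rightarrow> ('a, 'm, 'n) RA" where
  "genfun K c x y = (\<Sum>N\<le>K. RA_scale (c ^ N / fact N) (mode RA_Y N x y))"

lemma genfun_closed: "x \<in> homog l i \<Longrightarrow> y \<in> homog l j \<Longrightarrow> genfun K c x y \<in> homog l (i + j)"
  unfolding genfun_def
  by (intro RA.subspace_sum[OF subspace_homog] RA.subspace_scale[OF subspace_homog] mode_closed)

lemma ev_genfun:
  assumes "\<And>N. N > K \<Longrightarrow> mode RA_Y N x y = 0"
  shows "ev s t (genfun K c x y) = lam c s t (RA_Y x y)"
  by (simp add: lam_eq_sum_modes[OF assms] genfun_def additive.sum[OF additive_ev] ev_RA_scale)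

lemma ev_genfun_bracket:
  assumes "x \<in> homog l i" "y \<in> homog l j" "\<And>N. N > K \<Longrightarrow> mode RA_Y N x y = 0"
  shows "(\<lambda>s t. ev s t (genfun K c x y)) = super_bracket' (koszul_sign i j) c (\<lambda>s t. ev s t x) (\<lambda>s t. ev s t y)"
  by (intro ext) (simp add: ev_genfun[OF assms(3)] lam_RA_Y[OF assms(1,2)] super_bracket'_def)

lemma uniform_mode_bound:
  assumes "finite S"
  shows "\<exists>K. \<forall>(x, y)\<in>S. \<forall>N>K. mode Y N x y = 0"
  using assms
proof induction
  case (insert a S)
  then obtain K where K: "\<forall>(x, y)\<in>S. \<forall>N>K. mode Y N x y = 0" by blast
  obtain K' where "\<forall>N>K'. mode Y N (fst a) (snd a) = 0"
    using eventually_mode_eq_0 by blast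
  with K have "\<forall>(x, y)\<in>insert a S. \<forall>N>max K K'. mode Y N x y = 0"
    by auto
  thus ?case by blast
qed simp

lemma genfun2_left:
  assumes u: "u \<in> homog l i" and v: "v \<in> homog l j" and w: "w \<in> homog l h"
    and 1: "\<And>N. N > K \<Longrightarrow> mode RA_Y N v w = 0"
    and 2: "\<And>N n. N > K \<Longrightarrow> mode RA_Y N u (mode RA_Y n v w) = 0"
  shows "(\<Sum>m\<le>K. \<Sum>n\<le>K. cmat (c ^ m / fact m * (d ^ n / fact n)) (ev s t (mode RA_Y m u (mode RA_Y n v w))))
    = super_bracket (koszul_sign i (j + h)) c s t (\<lambda>s t. ev s t u)
       (super_bracket' (koszul_sign j h) d (\<lambda>s t. ev s t v) (\<lambda>s t. ev s t w))"
proof -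
  have m: "mode RA_Y m u (genfun K d v w) = (\<Sum>n\<le>K. RA_scale (d ^ n / fact n) (mode RA_Y m u (mode RA_Y n v w)))" for m
    by (simp add: genfun_def mode_sum_scale)
  have "(\<Sum>m\<le>K. \<Sum>n\<le>K. cmat (c ^ m / fact m * (d ^ n / fact n)) (ev s t (mode RA_Y m u (mode RA_Y n v w))))
    = (\<Sum>m\<le>K. cmat (c ^ m / fact m) (ev s t (mode RA_Y m u (genfun K d v w))))"
    by (simp add: m additive.sum[OF additive_ev] ev_RA_scale cmat_sum)
  also have "\<dots> = lam c s t (RA_Y u (genfun K d v w))"
    by (rule lam_eq_sum_modes[symmetric]) (simp add: m 2)
  also have "\<dots> = super_bracket (koszul_sign i (j + h)) c s t (\<lambda>s t. ev s t u)
       (\<lambda>s t. ev s t (genfun K d v w))"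
    by (rule lam_RA_Y[OF u genfun_closed[OF v w]])
  also have "(\<lambda>s t. ev s t (genfun K d v w)) = super_bracket' (koszul_sign j h) d (\<lambda>s t. ev s t v) (\<lambda>s t. ev s t w)"
    by (rule ev_genfun_bracket[OF v w 1])
  finally show ?thesis .
qed

text \<open>\<open>commutator_genfun\<close> regroups the binomial sum by the inner index r;
  linearity of modes then turns it into a bracket with the single element
  \<open>genfun L c u v\<close>. The range 2K <= L accommodates the bound K in both the inner and
  the outer index.\<close>

lemma genfun2_right:
  assumes u: "u \<in> homog l i" and v: "v \<in> homog l j" and w: "w \<in> homog l h"
    and 1: "\<And>N. N > K \<Longrightarrow> mode RA_Y N u v = 0"
    and 2: "\<And>N r. N > K \<Longrightarrow> mode RA_Y N (mode RA_Y r u v) w = 0" and L: "K + K \<le> L"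
  shows "(\<Sum>m\<le>L. \<Sum>n\<le>L. cmat (c ^ m / fact m * (d ^ n / fact n))
      (ev s t (\<Sum>r\<le>m. RA_scale (of_nat (m choose r)) (mode RA_Y (m + n - r) (mode RA_Y r u v) w))))
    = super_bracket (koszul_sign (i + j) h) (c + d) s t
       (super_bracket' (koszul_sign i j) c (\<lambda>s t. ev s t u) (\<lambda>s t. ev s t v)) (\<lambda>s t. ev s t w)"
proof -
  have bL: "mode RA_Y N u v = 0" if "N > L" for N
    using 1 L that by simp
  have m: "mode RA_Y m (genfun L c u v) w = (\<Sum>n\<le>L. RA_scale (c ^ n / fact n) (mode RA_Y m (mode RA_Y n u v) w))" for m
    by (simp add: genfun_def mode_sum_scale)
  have "(\<Sum>m\<le>L. \<Sum>n\<le>L. cmat (c ^ m / fact m * (d ^ n / fact n))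
      (ev s t (\<Sum>r\<le>m. RA_scale (of_nat (m choose r)) (mode RA_Y (m + n - r) (mode RA_Y r u v) w))))
    = (\<Sum>r\<le>L. cmat (c ^ r / fact r) (\<Sum>M\<le>L. cmat ((c + d) ^ M / fact M) (ev s t (mode RA_Y M (mode RA_Y r u v) w))))"
  proof -
    have "(\<Sum>m\<le>L. \<Sum>n\<le>L. c ^ m / fact m * (d ^ n / fact n) *
        (\<Sum>r\<le>m. of_nat (m choose r) * ev s t (mode RA_Y (m + n - r) (mode RA_Y r u v) w) $ p $ q))
      = (\<Sum>r\<le>L. c ^ r / fact r * (\<Sum>M\<le>L. (c + d) ^ M / fact M * ev s t (mode RA_Y M (mode RA_Y r u v) w) $ p $ q))" for p q
      by (rule commutator_genfun[OF _ L])
        (auto simp: 1 2 additive.zero[OF additive_ev] additive.zero[OF additive_mode_left])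
    thus ?thesis
      by (simp add: vec_eq_iff sum_component additive.sum[OF additive_ev] ev_RA_scale)
  qed
  also have "\<dots> = (\<Sum>M\<le>L. cmat ((c + d) ^ M / fact M) (ev s t (mode RA_Y M (genfun L c u v) w)))"
    unfolding m additive.sum[OF additive_ev] ev_RA_scale cmat_sum
    by (subst sum.swap) (simp add: mult.commute)
  also have "\<dots> = lam (c + d) s t (RA_Y (genfun L c u v) w)"
    by (rule lam_eq_sum_modes[symmetric]) (use L in \<open>simp add: m 2\<close>)
  also have "\<dots> = super_bracket (koszul_sign (i + j) h) (c + d) s t
       (\<lambda>s t. ev s t (genfun L c u v)) (\<lambda>s t. ev s t w)"
    by (rule lam_RA_Y[OF genfun_closed[OF u v] w])
  also have "(\<lambda>s t. ev s t (genfun L c u v)) = super_bracket' (koszul_sign i j) c (\<lambda>s t. ev s t u) (\<lambda>s t. ev s t v)"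
    by (rule ev_genfun_bracket[OF u v bL])
  finally show ?thesis .
qed

lemma homog_commutator:
  assumes u: "u \<in> homog l i" and v: "v \<in> homog l j" and w: "w \<in> homog l h"
  shows "mode RA_Y m u (mode RA_Y n v w) - RA_scale (koszul_sign i j) (mode RA_Y n v (mode RA_Y m u w))
    = (\<Sum>r\<le>m. RA_scale (of_nat (m choose r)) (mode RA_Y (m + n - r) (mode RA_Y r u v) w))"
proof -
  obtain K0 where K0: "\<forall>(x, y)\<in>{(u, v), (v, w), (u, w)}. \<forall>N>K0. mode RA_Y N x y = 0"
    using uniform_mode_bound[of "{(u, v), (v, w), (u, w)}" RA_Y] by auto
  \<comment> \<open>Inner modes beyond K0 are zero, so only finitely many outer pairs remain to be
    bounded.\<close>
  let ?S = "(\<lambda>n. (u, mode RA_Y n v w)) ` {..K0} \<union> (\<lambda>n. (v, mode RA_Y n u w)) ` {..K0} \<union> (\<lambda>n. (mode RA_Y n u v, w)) ` {..K0}"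
  obtain K1 where K1: "\<forall>(x, y)\<in>?S. \<forall>N>K1. mode RA_Y N x y = 0"
    using uniform_mode_bound[of ?S RA_Y] by auto
  define K where "K = max K0 K1"
  \<comment> \<open>\<open>genfun2_right\<close> asks for K + K; m and n are included so that the
    wanted coefficient is in range.\<close>
  define L where "L = max (K + K) (max m n)"
  have b1: "mode RA_Y N u v = 0" "mode RA_Y N v w = 0" "mode RA_Y N u w = 0" if "N > K" for N
    using K0 that by (auto simp: K_def)
  have b2: "mode RA_Y N u (mode RA_Y r v w) = 0" "mode RA_Y N v (mode RA_Y r u w) = 0"
    "mode RA_Y N (mode RA_Y r u v) w = 0" if "N > K" for N r
  proof -
    have "r \<le> K0 \<or> mode RA_Y r v w = 0" "r \<le> K0 \<or> mode RA_Y r u w = 0" "r \<le> K0 \<or> mode RA_Y r u v = 0"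
      using K0 by (auto simp: not_le[symmetric])
    with K1 that show "mode RA_Y N u (mode RA_Y r v w) = 0" "mode RA_Y N v (mode RA_Y r u w) = 0"
      "mode RA_Y N (mode RA_Y r u v) w = 0"
      by (auto simp: K_def additive.zero[OF additive_mode_left] additive.zero[OF additive_mode_right])
  qed
  have KL: "K \<le> L" "m \<le> L" "n \<le> L" "K + K \<le> L"
    by (auto simp: L_def)
  show ?thesis
  proof (rule genfun2_inject[where K = L and l = l and
        f = "\<lambda>m n. mode RA_Y m u (mode RA_Y n v w) - RA_scale (koszul_sign i j) (mode RA_Y n v (mode RA_Y m u w))"
        and g = "\<lambda>m n. \<Sum>r\<le>m. RA_scale (of_nat (m choose r)) (mode RA_Y (m + n - r) (mode RA_Y r u v) w)"])
    fix m n
    have "mode RA_Y m u (mode RA_Y n v w) \<in> aligned l" "mode RA_Y n v (mode RA_Y m u w) \<in> aligned l"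
      "mode RA_Y r (mode RA_Y r' u v) w \<in> aligned l" for r r'
      using u v w homog_subset_aligned mode_closed by blast+
    thus "mode RA_Y m u (mode RA_Y n v w) - RA_scale (koszul_sign i j) (mode RA_Y n v (mode RA_Y m u w)) \<in> aligned l"
      "(\<Sum>r\<le>m. RA_scale (of_nat (m choose r)) (mode RA_Y (m + n - r) (mode RA_Y r u v) w)) \<in> aligned l"
      by (intro RA.subspace_diff[OF subspace_aligned] RA.subspace_sum[OF subspace_aligned]
          RA.subspace_scale[OF subspace_aligned]; simp)+
  next
    fix c d s t :: 'a
    let ?U = "\<lambda>s t. ev s t u" and ?V = "\<lambda>s t. ev s t v" and ?W = "\<lambda>s t. ev s t w"
    have swap: "(\<Sum>m\<le>L. \<Sum>n\<le>L. cmat (c ^ m / fact m * (d ^ n / fact n)) (ev s t (mode RA_Y n v (mode RA_Y m u w))))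
      = (\<Sum>m\<le>L. \<Sum>n\<le>L. cmat (d ^ m / fact m * (c ^ n / fact n)) (ev s t (mode RA_Y m v (mode RA_Y n u w))))"
      by (subst sum.swap) (simp add: mult.commute)
    have "(\<Sum>m\<le>L. \<Sum>n\<le>L. cmat (c ^ m / fact m * (d ^ n / fact n))
        (ev s t (mode RA_Y m u (mode RA_Y n v w) - RA_scale (koszul_sign i j) (mode RA_Y n v (mode RA_Y m u w)))))
      = (\<Sum>m\<le>L. \<Sum>n\<le>L. cmat (c ^ m / fact m * (d ^ n / fact n)) (ev s t (mode RA_Y m u (mode RA_Y n v w))))
      - cmat (koszul_sign i j) (\<Sum>m\<le>L. \<Sum>n\<le>L. cmat (c ^ m / fact m * (d ^ n / fact n)) (ev s t (mode RA_Y n v (mode RA_Y m u w))))"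
      by (simp add: additive.diff[OF additive_ev] ev_RA_scale cmat_diff sum_subtractf cmat_sum mult_ac
          flip: sum_distrib_left)
    also have "\<dots> = (\<Sum>m\<le>L. \<Sum>n\<le>L. cmat (c ^ m / fact m * (d ^ n / fact n)) (ev s t (mode RA_Y m u (mode RA_Y n v w))))
      - cmat (koszul_sign i j) (\<Sum>m\<le>L. \<Sum>n\<le>L. cmat (d ^ m / fact m * (c ^ n / fact n)) (ev s t (mode RA_Y m v (mode RA_Y n u w))))"
      unfolding swap ..
    also have "\<dots> = super_bracket (koszul_sign i (j + h)) c s t ?U (super_bracket' (koszul_sign j h) d ?V ?W)
      - cmat (koszul_sign i j) (super_bracket (koszul_sign j (i + h)) d s t ?V (super_bracket' (koszul_sign i h) c ?U ?W))"
    proof -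
      have "mode RA_Y N v w = 0" "mode RA_Y N u w = 0"
        "mode RA_Y N u (mode RA_Y r v w) = 0" "mode RA_Y N v (mode RA_Y r u w) = 0" if "N > L" for N r
        using that KL b1 b2 by simp_all
      thus ?thesis
        by (simp only: genfun2_left[OF u v w] genfun2_left[OF v u w])
    qed
    also have "\<dots> = super_bracket (koszul_sign (i + j) h) (c + d) s t (super_bracket' (koszul_sign i j) c ?U ?V) ?W"
      using super_bracket_jacobi[OF koszul_sign_simps(3)[of i j], where y = "koszul_sign i h" and z = "koszul_sign j h"]
      by (simp only: koszul_sign_simps koszul_sign_commute[of j i])
    also have "\<dots> = (\<Sum>m\<le>L. \<Sum>n\<le>L. cmat (c ^ m / fact m * (d ^ n / fact n))
      (ev s t (\<Sum>r\<le>m. RA_scale (of_nat (m choose r)) (mode RA_Y (m + n - r) (mode RA_Y r u v) w))))"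
      by (rule genfun2_right[OF u v w b1(1) b2(3) KL(4), symmetric])
    finally show "(\<Sum>m\<le>L. \<Sum>n\<le>L. cmat (c ^ m / fact m * (d ^ n / fact n))
        (ev s t (mode RA_Y m u (mode RA_Y n v w) - RA_scale (koszul_sign i j) (mode RA_Y n v (mode RA_Y m u w)))))
      = (\<Sum>m\<le>L. \<Sum>n\<le>L. cmat (c ^ m / fact m * (d ^ n / fact n))
      (ev s t (\<Sum>r\<le>m. RA_scale (of_nat (m choose r)) (mode RA_Y (m + n - r) (mode RA_Y r u v) w))))" .
  qed (use KL in auto)
qed

lemma ev_RA_deriv_pow: "ev s t ((RA_deriv ^^ k) x) = cmat ((s + t) ^ k) (ev s t x)"
  by (induction k) (simp_all add: ev_RA_deriv)

lemma RA_deriv_pow_closed: "x \<in> homog l i \<Longrightarrow> (RA_deriv ^^ k) x \<in> homog l i"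
  by (induction k) (simp_all add: RA_deriv_closed)

lemma RA_deriv_pow_0: "(RA_deriv ^^ k) 0 = 0"
  by (induction k) (simp_all add: additive.zero[OF additive_RA_deriv])

lemma homog_skew_symmetry:
  fixes u v :: "('a::field_char_0, 'm::finite, 'n::finite) RA"
  assumes u: "u \<in> homog l i" and v: "v \<in> homog l j"
  shows "mode RA_Y n u v = RA_scale (koszul_sign i j)
    (\<Sum>k | mode RA_Y (n + k) v u \<noteq> 0.
       RA_scale ((- 1) ^ (n + k + 1) / fact k) ((RA_deriv ^^ k) (mode RA_Y (n + k) v u)))"
proof -
  obtain K0 where K0: "\<forall>(x, y)\<in>{(u, v), (v, u)}. \<forall>N>K0. mode RA_Y N x y = 0"
    using uniform_mode_bound[of "{(u, v), (v, u)}" RA_Y] by auto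
  define K where "K = max K0 n"
  have b: "mode RA_Y N u v = 0" "mode RA_Y N v u = 0" if "N > K" for N
    using K0 that by (auto simp: K_def)
  \<comment> \<open>The sum over nonzero modes is replaced by a range independent of n; the added
    terms are derivatives of 0.\<close>
  define g where "g n = RA_scale (koszul_sign i j)
    (\<Sum>k\<le>K. RA_scale ((- 1) ^ (n + k + 1) / fact k) ((RA_deriv ^^ k) (mode RA_Y (n + k) v u)))" for n
  have "mode RA_Y n u v = g n"
  proof (rule genfun_inject[where K = K and l = l and f = "\<lambda>n. mode RA_Y n u v"])
    fix N
    show "mode RA_Y N u v \<in> aligned l"
      using mode_closed[OF u v] homog_subset_aligned by blast
    have "g N \<in> homog l (j + i)"
      unfolding g_def
      by (intro RA.subspace_sum[OF subspace_homog] RA.subspace_scale[OF subspace_homog]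
          RA_deriv_pow_closed mode_closed u v)
    thus "g N \<in> aligned l"
      using homog_subset_aligned by blast
  next
    fix c s t :: 'a
    have sum: "(\<Sum>n\<le>K. \<Sum>k\<le>K. cmat (c ^ n / fact n * ((- 1) ^ (n + k + 1) / fact k * (s + t) ^ k)) (ev s t (mode RA_Y (n + k) v u)))
      = - lam (- c - (s + t)) s t (RA_Y v u)"
    proof -
      have "(\<Sum>n\<le>K. \<Sum>k\<le>K. c ^ n / fact n * ((- 1) ^ (n + k + 1) / fact k * ((s + t) ^ k * (ev s t (mode RA_Y (n + k) v u) $ p $ q))))
        = - (\<Sum>N\<le>K. (- c - (s + t)) ^ N / fact N * (ev s t (mode RA_Y N v u) $ p $ q))" for p q
        by (rule skew_symmetry_genfun) (simp add: b additive.zero[OF additive_ev])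
      thus ?thesis
        by (simp add: lam_eq_sum_modes[OF b(2)] vec_eq_iff sum_component mult.assoc)
    qed
    have "(\<Sum>N\<le>K. cmat (c ^ N / fact N) (ev s t (g N)))
      = cmat (koszul_sign i j) (\<Sum>n\<le>K. \<Sum>k\<le>K. cmat (c ^ n / fact n * ((- 1) ^ (n + k + 1) / fact k * (s + t) ^ k)) (ev s t (mode RA_Y (n + k) v u)))"
      by (simp only: g_def ev_RA_scale additive.sum[OF additive_ev] ev_RA_deriv_pow cmat_sum cmat_simps mult_ac)
    also have "\<dots> = - cmat (koszul_sign i j) (super_bracket (koszul_sign i j) (- c - s - t) s t (\<lambda>s t. ev s t v) (\<lambda>s t. ev s t u))"
      unfolding sum lam_RA_Y[OF v u] by (simp add: cmat_minus koszul_sign_commute[of j i] algebra_simps)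
    also have "\<dots> = lam c s t (RA_Y u v)"
      unfolding lam_RA_Y[OF u v] by (rule super_bracket_skew[symmetric]) (rule koszul_sign_simps)
    also have "\<dots> = (\<Sum>N\<le>K. cmat (c ^ N / fact N) (ev s t (mode RA_Y N u v)))"
      by (rule lam_eq_sum_modes) (rule b)
    finally show "(\<Sum>N\<le>K. cmat (c ^ N / fact N) (ev s t (mode RA_Y N u v))) = (\<Sum>N\<le>K. cmat (c ^ N / fact N) (ev s t (g N)))" ..
  qed (simp add: K_def)
  also have "(\<Sum>k\<le>K. RA_scale ((- 1) ^ (n + k + 1) / fact k) ((RA_deriv ^^ k) (mode RA_Y (n + k) v u)))
    = (\<Sum>k | mode RA_Y (n + k) v u \<noteq> 0.
       RA_scale ((- 1) ^ (n + k + 1) / fact k) ((RA_deriv ^^ k) (mode RA_Y (n + k) v u)))"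
  proof (rule sum.mono_neutral_right)
    have "k \<le> K" if "mode RA_Y (n + k) v u \<noteq> 0" for k
      using b(2)[of "n + k"] that by (cases "k \<le> K") auto
    thus "{k. mode RA_Y (n + k) v u \<noteq> 0} \<subseteq> {..K}" by blast
  qed (auto simp: RA_deriv_pow_0)
  hence "g n = RA_scale (koszul_sign i j) (\<Sum>k | mode RA_Y (n + k) v u \<noteq> 0.
       RA_scale ((- 1) ^ (n + k + 1) / fact k) ((RA_deriv ^^ k) (mode RA_Y (n + k) v u)))"
    unfolding g_def by simp
  finally show ?thesis .
qed

text \<open>The derivation multiplies U by the sum of its two arguments, which is -c in both
  summands of the bracket. For n = 0 the truncated index n - 1 is harmless, since the coefficient is
  0.\<close>

lemma homog_mode_deriv:
  fixes u v :: "('a::field_char_0, 'm::finite, 'n::finite) RA"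
  assumes u: "u \<in> homog l i" and v: "v \<in> homog l j"
  shows "mode RA_Y n (RA_deriv u) v = RA_scale (- of_nat n) (mode RA_Y (n - 1) u v)"
proof -
  obtain K0 where K0: "\<forall>(x, y)\<in>{(u, v), (RA_deriv u, v)}. \<forall>N>K0. mode RA_Y N x y = 0"
    using uniform_mode_bound[of "{(u, v), (RA_deriv u, v)}" RA_Y] by auto
  define K where "K = Suc (max K0 n)"
  have b: "mode RA_Y N u v = 0" "mode RA_Y N (RA_deriv u) v = 0" if "N \<ge> K" for N
    using K0 that by (auto simp: K_def)
  note Du = RA_deriv_closed[OF u]
  show ?thesis
  proof (rule genfun_inject[where K = K and l = l and f = "\<lambda>n. mode RA_Y n (RA_deriv u) v"
        and g = "\<lambda>n. RA_scale (- of_nat n) (mode RA_Y (n - 1) u v)"])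
    fix N
    show "mode RA_Y N (RA_deriv u) v \<in> aligned l"
      using mode_closed[OF Du v] homog_subset_aligned by blast
    show "RA_scale (- of_nat N) (mode RA_Y (N - 1) u v) \<in> aligned l"
      using mode_closed[OF u v] homog_subset_aligned by (blast intro: RA.subspace_scale[OF subspace_aligned])
  next
    fix c s t :: 'a
    obtain K' where K': "K = Suc K'" by (auto simp: K_def)
    have "(\<Sum>N\<le>K. cmat (c ^ N / fact N) (ev s t (mode RA_Y N (RA_deriv u) v))) = lam c s t (RA_Y (RA_deriv u) v)"
      by (rule lam_eq_sum_modes[symmetric]) (simp add: b)
    also have "\<dots> = cmat (- c) (lam c s t (RA_Y u v))"
      unfolding lam_RA_Y[OF Du v] lam_RA_Y[OF u v]
      by (simp add: super_bracket_def ev_RA_deriv cmat_diff mult.commute)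
    also have "\<dots> = cmat (- c) (\<Sum>N\<le>K'. cmat (c ^ N / fact N) (ev s t (mode RA_Y N u v)))"
      by (subst lam_eq_sum_modes[of K']) (simp_all add: b K')
    also have "\<dots> = (\<Sum>N\<le>K'. cmat (c ^ Suc N / fact (Suc N)) (ev s t (RA_scale (- of_nat (Suc N)) (mode RA_Y N u v))))"
      unfolding cmat_sum
    proof (intro sum.cong refl)
      fix N
      have "- c * (c ^ N / fact N) = c ^ Suc N / fact (Suc N) * - of_nat (Suc N)"
        by (simp add: fact_Suc field_simps del: of_nat_Suc)
      thus "cmat (- c) (cmat (c ^ N / fact N) (ev s t (mode RA_Y N u v)))
        = cmat (c ^ Suc N / fact (Suc N)) (ev s t (RA_scale (- of_nat (Suc N)) (mode RA_Y N u v)))"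
        by (simp only: ev_RA_scale cmat_simps)
    qed
    also have "\<dots> = (\<Sum>N\<le>K. cmat (c ^ N / fact N) (ev s t (RA_scale (- of_nat N) (mode RA_Y (N - 1) u v))))"
      unfolding K' by (subst sum.atMost_Suc_shift) (simp add: additive.zero[OF additive_ev] del: of_nat_Suc fact_Suc power_Suc)
    finally show "(\<Sum>N\<le>K. cmat (c ^ N / fact N) (ev s t (mode RA_Y N (RA_deriv u) v))) = \<dots>" .
  qed (simp add: K_def)
qed

lemma whole_homogE:
  assumes "w \<in> whole (homog l)"
  obtains w0 w1 where "w0 \<in> homog l 0" "w1 \<in> homog l 1" "w = w0 + w1"
  using assms by (auto simp: whole_def)

theorem conformal_superalgebra_homog:
  "conformal_superalgebra RA_scale
     (homog l :: bit \<Rightarrow> ('a::field_char_0, 'm::finite, 'n::finite) RA set) RA_deriv RA_Y"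
proof
  fix u v w :: "('a, 'm, 'n) RA" and i j and m n :: nat
  assume uv: "u \<in> homog l i" "v \<in> homog l j" and w: "w \<in> whole (homog l)"
  obtain w0 w1 where "w0 \<in> homog l 0" "w1 \<in> homog l 1" "w = w0 + w1"
    using w by (rule whole_homogE)
  thus "mode RA_Y m u (mode RA_Y n v w) - RA_scale (koszul_sign i j) (mode RA_Y n v (mode RA_Y m u w))
    = (\<Sum>r\<le>m. RA_scale (of_nat (m choose r)) (mode RA_Y (m + n - r) (mode RA_Y r u v) w))"
    using homog_commutator[OF uv, of w0 0 m n] homog_commutator[OF uv, of w1 1 m n]
    by (simp add: additive.add[OF additive_mode_right] RA.scale_right_distrib sum.distrib algebra_simps)
next
  fix u v :: "('a, 'm, 'n) RA" and i j e
  assume uv: "u \<in> homog l i" "v \<in> homog l j"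
  show "Poly_Mapping.lookup (RA_Y (RA_deriv u) v) e = RA_scale (of_int (e + 1)) (Poly_Mapping.lookup (RA_Y u v) (e + 1))"
  proof (cases "e < 0")
    case True
    define n where "n = nat (- e - 1)"
    have e: "e = - int n - 1"
      using True by (simp add: n_def)
    have *: "mode RA_Y n (RA_deriv u) v = RA_scale (- of_nat n) (mode RA_Y (n - 1) u v)"
      by (rule homog_mode_deriv[OF uv])
    show ?thesis
    proof (cases n)
      case 0
      with * show ?thesis by (simp add: e mode_def)
    next
      case (Suc k)
      hence "e + 1 = - int k - 1" "of_int (e + 1) = (- of_nat n :: 'a)"
        by (simp_all add: e)
      with * Suc show ?thesis by (simp only: mode_def e diff_Suc_1)
    qed
  next
    case False
    hence "Poly_Mapping.lookup (RA_Y x y) e = 0" "Poly_Mapping.lookup (RA_Y x y) (e + 1) = 0" for x y :: "('a, 'm, 'n) RA"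
      using keys_RA_Y[of x y] by (auto simp: in_keys_iff subset_iff)
    thus ?thesis by simp
  qed
next
  fix u v :: "('a, 'm, 'n) RA" and i j and e :: int and n :: nat
  assume uv: "u \<in> homog l i" "v \<in> homog l j"
  show "Poly_Mapping.lookup (RA_Y u v) e \<in> homog l (i + j)"
    by (rule RA_Y_closed[OF uv])
  show "mode RA_Y n u v = RA_scale (koszul_sign i j)
    (\<Sum>k | mode RA_Y (n + k) v u \<noteq> 0.
       RA_scale ((- 1) ^ (n + k + 1) / fact k) ((RA_deriv ^^ k) (mode RA_Y (n + k) v u)))"
    by (rule homog_skew_symmetry[OF uv])
qed (auto intro: subspace_homog RA_deriv_closed
    simp: homog_direct keys_RA_Y additive.add[OF additive_RA_deriv] RA_deriv_scale
      additive.add[OF additive_RA_Y_left] additive.add[OF additive_RA_Y_right] RA_Y_scale_left RA_Y_scale_right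
    dest: keys_RA_Y[THEN subsetD])

subsection \<open>Modes of the basis elements\<close>

definition half_coeff :: "nat \<Rightarrow> nat \<Rightarrow> nat \<Rightarrow> 'a::field_char_0" where
  "half_coeff d n m = of_nat (n * d + 1) * (of_int (- int n - 1 - int d) gchoose m)"

text \<open>The upper entry of the binomial is a negative integer, so no factor vanishes in
  characteristic 0. Hence a half that is isolated in a mode yields its basis element.\<close>

lemma half_coeff_nonzero: "half_coeff d n m \<noteq> (0 :: 'a::field_char_0)"
proof -
  have "(of_int (- int n - 1 - int d) :: 'a) = - of_nat (Suc (n + d))"
    by simp
  hence "(of_int (- int n - 1 - int d) gchoose m :: 'a) \<noteq> 0"
    by (simp add: gbinomial_minus_nat del: of_nat_Suc)
  moreover have "(of_nat (n * d + 1) :: 'a) \<noteq> 0"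
    by (simp only: of_nat_eq_0_iff)
  ultimately show ?thesis
    by (simp only: half_coeff_def mult_eq_0_iff de_Morgan_disj) blast
qed

lemma kdelta_simps [simp]: "kdelta x x = 1" "kdelta 0 1 = 0" "kdelta 1 0 = 0"
  by (simp_all add: kdelta_def)

lemma RA_Y_single: "RA_Y (Poly_Mapping.single a A) (Poly_Mapping.single b B) = RA_Y_elt A a B b"
  by (simp add: RA_Y_eq_psum psum_single additive_RA_Y_elt_left additive_RA_Y_elt_right)

lemma mode_unit_elt:
  "mode RA_Y N (unit_elt k i m1 m2) (unit_elt i' q n1 n2) =
     (let p = m1 + m2 + n1 + wt i - N in
       if i = i' \<and> N \<le> m1 + m2 + n1 + wt i
       then RA_scale (half_coeff (wt i) n1 m2 * of_nat (p choose m1)) (unit_elt k q p n2) else 0)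
   - (let r = m1 + m2 + n2 + wt k - N in
       if q = k \<and> N \<le> m1 + m2 + n2 + wt k
       then RA_scale (koszul_sign (lab k + lab i) (lab i' + lab q) * (- 1) ^ wt k * half_coeff (wt k) n2 m1 * of_nat (r choose m2))
         (unit_elt i' i n1 r) else 0)"
proof -
  have sg: "(of_nat (kdelta (lab k) 1) - of_nat ((n2 + 1) * wt k) :: 'a)
      = (- 1) ^ wt k * of_nat (n2 * wt k + 1)"
    by (cases k) (auto simp: kdelta_def)
  have [simp]: "nat (- (- int N - 1) - 1) = N" by simp
  have [simp]: "- int N - 1 < 0" by simp
  show ?thesis
    unfolding mode_def unit_elt_def elt_def RA_Y_single lookup_RA_Y_elt Let_def matrix_unit_mult sg half_coeff_def
    by (auto simp: elt_def mult.assoc)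
qed

lemma subspace_cancel_scale: "RA.subspace G \<Longrightarrow> RA_scale c x \<in> G \<Longrightarrow> c \<noteq> 0 \<Longrightarrow> x \<in> G"
  using RA.subspace_scale[of G "RA_scale c x" "inverse c"] by simp

text \<open>To be instantiated with the span of the monomials; closure under modes between any two
  of its elements allows elements already found to act as generators.\<close>

locale mode_closed_subspace =
  fixes G :: "('a::field_char_0, 'm::finite, 'n::finite) RA set"
  assumes G: "RA.subspace G"
    and closed: "\<And>x y n. x \<in> G \<Longrightarrow> y \<in> G \<Longrightarrow> mode RA_Y n x y \<in> G"
begin

text \<open>The mode is chosen so that the first half of the product is E_kq with exponents (p, n2).
  The second half is a multiple of E_ii, present only if q = k, and its binomial vanishes for r <
  m2; the last hypothesis supplies it in the remaining case.\<close>

lemma diag_left: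
  assumes "unit_elt k i m1 m2 \<in> G" "unit_elt i q n1 n2 \<in> G"
    and p: "m1 \<le> p" "p \<le> m1 + m2 + n1 + wt i"
    and r: "\<And>r. q = k \<Longrightarrow> m2 \<le> r \<Longrightarrow> r + (m1 + m2 + n1 + wt i) = m1 + m2 + n2 + wt k + p \<Longrightarrow> unit_elt i i n1 r \<in> G"
  shows "unit_elt k q p n2 \<in> G"
proof -
  define N where "N = m1 + m2 + n1 + wt i - p"
  define r where "r = m1 + m2 + n2 + wt k - N"
  let ?c = "koszul_sign (lab k + lab i) (lab i + lab q) * (- 1) ^ wt k * half_coeff (wt k) n2 m1 * of_nat (r choose m2)"
  let ?x = "if q = k \<and> N \<le> m1 + m2 + n2 + wt k then RA_scale ?c (unit_elt i i n1 r) else 0"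
  have p': "m1 + m2 + n1 + wt i - N = p" "N \<le> m1 + m2 + n1 + wt i"
    using p by (auto simp: N_def)
  have "?x \<in> G"
  proof (cases "q = k \<and> N \<le> m1 + m2 + n2 + wt k \<and> m2 \<le> r")
    case True
    hence "unit_elt i i n1 r \<in> G"
      using p' by (intro assms(5)) (auto simp: r_def)
    thus ?thesis
      using RA.subspace_0[OF G] RA.subspace_scale[OF G] by auto
  qed (auto simp: RA.subspace_0[OF G] not_le binomial_eq_0)
  moreover have eq: "mode RA_Y N (unit_elt k i m1 m2) (unit_elt i q n1 n2)
      = RA_scale (half_coeff (wt i) n1 m2 * of_nat (p choose m1)) (unit_elt k q p n2) - ?x"
    unfolding mode_unit_elt Let_def p'(1) r_def[symmetric] by (simp only: p' simp_thms if_True)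
  ultimately have "RA_scale (half_coeff (wt i) n1 m2 * of_nat (p choose m1)) (unit_elt k q p n2) \<in> G"
    using RA.subspace_add[OF G closed[OF assms(1,2), of N]] unfolding eq by fastforce
  moreover have "half_coeff (wt i) n1 m2 * of_nat (p choose m1) \<noteq> (0 :: 'a)"
    using p by (simp add: half_coeff_nonzero)
  ultimately show ?thesis
    by (rule subspace_cancel_scale[OF G])
qed

text \<open>The mirror image: the second half is kept, and the by-product is a multiple of
  E_kk.\<close>

lemma diag_right:
  assumes "unit_elt k i m1 m2 \<in> G" "unit_elt p k n1 n2 \<in> G"
    and r: "m2 \<le> r" "r \<le> m1 + m2 + n2 + wt k"
    and q: "\<And>q. i = p \<Longrightarrow> m1 \<le> q \<Longrightarrow> q + (m1 + m2 + n2 + wt k) = m1 + m2 + n1 + wt i + r \<Longrightarrow> unit_elt k k q n2 \<in> G"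
  shows "unit_elt p i n1 r \<in> G"
proof -
  define N where "N = m1 + m2 + n2 + wt k - r"
  define q where "q = m1 + m2 + n1 + wt i - N"
  let ?c = "half_coeff (wt i) n1 m2 * of_nat (q choose m1)"
  let ?d = "koszul_sign (lab k + lab i) (lab p + lab k) * (- 1) ^ wt k * half_coeff (wt k) n2 m1 * of_nat (r choose m2) :: 'a"
  let ?x = "if i = p \<and> N \<le> m1 + m2 + n1 + wt i then RA_scale ?c (unit_elt k k q n2) else 0"
  have r': "m1 + m2 + n2 + wt k - N = r" "N \<le> m1 + m2 + n2 + wt k"
    using r by (auto simp: N_def)
  have "?x \<in> G"
  proof (cases "i = p \<and> N \<le> m1 + m2 + n1 + wt i \<and> m1 \<le> q")
    case True
    hence "unit_elt k k q n2 \<in> G"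
      using r' by (intro assms(5)) (auto simp: q_def)
    thus ?thesis
      using RA.subspace_0[OF G] RA.subspace_scale[OF G] by auto
  qed (auto simp: RA.subspace_0[OF G] not_le binomial_eq_0)
  moreover have eq: "mode RA_Y N (unit_elt k i m1 m2) (unit_elt p k n1 n2) = ?x - RA_scale ?d (unit_elt p i n1 r)"
    unfolding mode_unit_elt Let_def r'(1) q_def[symmetric] by (simp only: r' simp_thms if_True)
  ultimately have "RA_scale ?d (unit_elt p i n1 r) \<in> G"
    using RA.subspace_diff[OF G _ closed[OF assms(1,2), of N], of ?x] unfolding eq by simp
  moreover have "?d \<noteq> 0"
    using r by (simp add: half_coeff_nonzero koszul_sign_def)
  ultimately show ?thesis
    by (rule subspace_cancel_scale[OF G])
qed

lemma block_generation:
  assumes ij: "unit_elt (Inl a) (Inr b) 0 l \<in> G" and ji: "unit_elt (Inr b) (Inl a) 0 l \<in> G"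
    and jj: "unit_elt (Inr b) (Inr b) 0 (l + 1) \<in> G" and n: "l \<le> n"
  shows "unit_elt (Inl a) (Inr b) m n \<in> G" "unit_elt (Inr b) (Inl a) m n \<in> G"
    "unit_elt (Inl a) (Inl a) m n \<in> G" "unit_elt (Inr b) (Inr b) m n \<in> G"
proof -
  \<comment> \<open>This product has the by-product E_bb with exponents (0, l+1), which is why the
    third generator is that element.\<close>
  have ii: "unit_elt (Inl a) (Inl a) 0 l \<in> G"
  proof (rule diag_left[OF ij ji])
    fix r assume "r + (0 + l + 0 + wt (Inr b :: 'm + 'n)) = 0 + l + l + wt (Inl a :: 'm + 'n) + 0"
    hence "r = l + 1" by simp
    thus "unit_elt (Inr b) (Inr b) 0 r \<in> G" using jj by simp
  qed auto
  \<comment> \<open>Raising an exponent by one needs room in the mode range, also for l = 0. For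
    E_aa it comes from weight 1 of the first block; the second block has weight 0, so E_bb must
    carry l+1 instead of l.\<close>
  have "unit_elt (Inl a) (Inr b) 0 n \<in> G" if "l \<le> n" for n
    using that
  proof (induction n rule: dec_induct)
    case (step n)
    show ?case by (rule diag_right[OF jj step.IH]) (use step in auto)
  qed (rule ij)
  hence ij': "unit_elt (Inl a) (Inr b) m n \<in> G" if "l \<le> n" for m n
  proof (induction m)
    case (Suc m)
    have "unit_elt (Inl a) (Inr b) m n \<in> G" using Suc by blast
    show ?case by (rule diag_left[OF ii \<open>unit_elt (Inl a) (Inr b) m n \<in> G\<close>]) auto
  qed (use that in auto)
  have "unit_elt (Inr b) (Inl a) 0 n \<in> G" if "l \<le> n" for n
    using that
  proof (induction n rule: dec_induct)
    case (step n)
    show ?case by (rule diag_right[OF ii step.IH]) (use step in auto)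
  qed (rule ji)
  hence ji': "unit_elt (Inr b) (Inl a) m n \<in> G" if "l \<le> n" for m n
  proof (induction m)
    case (Suc m)
    have "unit_elt (Inr b) (Inl a) m n \<in> G" using Suc by blast
    show ?case by (rule diag_left[OF jj \<open>unit_elt (Inr b) (Inl a) m n \<in> G\<close>]) auto
  qed (use that in auto)
  show "unit_elt (Inl a) (Inr b) m n \<in> G" "unit_elt (Inr b) (Inl a) m n \<in> G"
    using ij' ji' n by auto
  \<comment> \<open>Here and below, a by-product could only have second exponent at most m+n+1,
    which is less than l+m+n+2, so its binomial vanishes.\<close>
  show "unit_elt (Inl a) (Inl a) m n \<in> G"
    by (rule diag_left[OF ij'[of "l + m + n + 2" m] ji'[OF n, of 0]]) auto
  show "unit_elt (Inr b) (Inr b) m n \<in> G"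
    by (rule diag_left[OF ji'[of "l + m + n + 2" m] ij'[OF n, of 0]]) auto
qed

lemma generation:
  assumes ij: "\<And>a b. unit_elt (Inl a) (Inr b) 0 l \<in> G" and ji: "\<And>a b. unit_elt (Inr b) (Inl a) 0 l \<in> G"
    and jj: "\<And>b. unit_elt (Inr b) (Inr b) 0 (l + 1) \<in> G"
  shows "aligned l \<subseteq> G"
proof -
  have "unit_elt p q m n \<in> G" if n: "l \<le> n" for p q m n
  proof -
    note gen = block_generation[OF ij ji jj]
    \<comment> \<open>For distinct p and q the two halves cannot both be present, so there is no
      by-product.\<close>
    have through: "unit_elt p q m n \<in> G" if "unit_elt p r m l \<in> G" "unit_elt r q 0 n \<in> G" "p \<noteq> q" for p q r
      by (rule diag_left[OF that(1,2)]) (use that in auto)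
    show ?thesis
    proof (cases p)
      case p: (Inl a)
      show ?thesis
      proof (cases q)
        case q: (Inl a')
        show ?thesis
        proof (cases "a = a'")
          case False
          thus ?thesis unfolding p q
            using through[OF gen(1)[OF order_refl] gen(2)[OF n], of a a'] by blast
        qed (use p q gen n in auto)
      qed (use p gen n in auto)
    next
      case p: (Inr b)
      show ?thesis
      proof (cases q)
        case q: (Inr b')
        show ?thesis
        proof (cases "b = b'")
          case False
          thus ?thesis unfolding p q
            using through[OF gen(2)[OF order_refl] gen(1)[OF n], of b b'] by blast
        qed (use p q gen n in auto)
      qed (use p gen n in auto)
    qed
  qed
  thus ?thesis
    unfolding aligned_eq_span by (intro RA.span_minimal G) auto
qed

text \<open>A detour through the additional index avoids by-products and reaches E_ab with exponents
  (1, l). The raised first exponent is what separates the two halves of the last product.\<close>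

lemma third_generator:
  assumes ij: "\<And>a b. unit_elt (Inl a) (Inr b) 0 l \<in> G" and ji: "\<And>a b. unit_elt (Inr b) (Inl a) 0 l \<in> G"
    and card: "CARD('m) + CARD('n) > 2"
  shows "unit_elt (Inr b) (Inr b) 0 (l + 1) \<in> G"
proof -
  fix a :: 'm
  have "\<exists>a b'. a \<noteq> a' \<or> b' \<noteq> b" for a' :: 'm
  proof (rule ccontr)
    assume "\<not> ?thesis"
    hence "UNIV = {a'}" "UNIV = {b}" by auto
    hence "CARD('m) = 1" "CARD('n) = 1"
      by (metis card_1_singleton_iff One_nat_def)+
    with card show False by simp
  qed
  then consider a' where "a' \<noteq> a" | b' where "b' \<noteq> b" by blast
  hence "unit_elt (Inl a) (Inr b) 1 l \<in> G"
  proof cases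
    case 1
    have "unit_elt (Inl a) (Inl a') 0 l \<in> G"
      by (rule diag_left[OF ij[of a b] ji[of b a']]) (use 1 in auto)
    from diag_left[OF this ij[of a' b]] show ?thesis by simp
  next
    case 2
    have "unit_elt (Inr b') (Inr b) 1 l \<in> G"
      by (rule diag_left[OF ji[of b' a] ij[of a b]]) (use 2 in auto)
    from diag_left[OF ij[of a b'] this] show ?thesis by simp
  qed
  \<comment> \<open>The by-product E_aa would have first exponent 0, below the 1 carried by the
    acting element.\<close>
  from diag_right[OF this ji[of b a]] show ?thesis by simp
qed

end

subsection \<open>Simplicity\<close>

type_synonym ('m, 'n) index = "('m + 'n) \<times> ('m + 'n) \<times> nat \<times> nat"

definition entry :: "('a::field_char_0, 'm::finite, 'n::finite) RA \<Rightarrow> ('m, 'n) index \<Rightarrow> 'a" where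
  "entry x = (\<lambda>(p, q, m, n). Poly_Mapping.lookup x (lab p, lab q, m, n) $ p $ q)"

definition basis_elt :: "('m::finite, 'n::finite) index \<Rightarrow> ('a::field_char_0, 'm, 'n) RA" where
  "basis_elt = (\<lambda>(p, q, m, n). unit_elt p q m n)"

lemma entry_sum_scale:
  "entry (\<Sum>i\<in>I. RA_scale (f i) (x i)) z = (\<Sum>i\<in>I. f i * entry (x i) z)"
  by (cases z) (simp add: entry_def additive.sum[OF additive_lookup] sum_component RA_scale_lookup)

lemma entry_basis_elt: "entry (basis_elt y) z = (if y = z then 1 else 0)"
  by (cases y; cases z) (auto simp: entry_def basis_elt_def unit_elt_def elt_def lookup_single when_def)

lemma finite_entry: "finite {z. entry x z \<noteq> 0}"
proof (rule finite_subset)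
  show "{z. entry x z \<noteq> 0} \<subseteq> (\<lambda>((i, j, m, n), p, q). (p, q, m, n)) ` (Poly_Mapping.keys x \<times> UNIV)"
  proof
    fix z assume z: "z \<in> {z. entry x z \<noteq> 0}"
    obtain p q m n where z': "z = (p, q, m, n)" by (cases z) auto
    have "(lab p, lab q, m, n) \<in> Poly_Mapping.keys x"
      using z by (auto simp: z' entry_def in_keys_iff)
    thus "z \<in> (\<lambda>((i, j, m, n), p, q). (p, q, m, n)) ` (Poly_Mapping.keys x \<times> UNIV)"
      unfolding z' by (intro image_eqI[of _ _ "((lab p, lab q, m, n), p, q)"]) auto
  qed
qed auto

lemma entry_inject:
  assumes "x \<in> aligned l" "y \<in> aligned l'" "\<And>z. entry x z = entry y z"
  shows "x = y"
proof (rule poly_mapping_eqI)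
  fix a :: "bit \<times> bit \<times> nat \<times> nat"
  obtain i j m n where a: "a = (i, j, m, n)" by (cases a) auto
  have b: "block (Poly_Mapping.lookup x a) i j" "block (Poly_Mapping.lookup y a) i j"
    using assms(1,2) by (auto simp: aligned_def a)
  have "Poly_Mapping.lookup x a $ p $ q = Poly_Mapping.lookup y a $ p $ q" for p q
  proof (cases "lab p = i \<and> lab q = j")
    case True
    thus ?thesis
      using assms(3)[of "(p, q, m, n)"] by (auto simp: entry_def a)
  next
    case False
    thus ?thesis
      using b[THEN block_nth_eq_0, of p q] by auto
  qed
  thus "Poly_Mapping.lookup x a = Poly_Mapping.lookup y a"
    by (simp add: vec_eq_iff)
qed

lemma unit_elt_aligned: "l \<le> n \<Longrightarrow> unit_elt p q m n \<in> aligned l"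
  unfolding aligned_eq_span by (intro RA.span_base) blast

lemma entry_nonzero: "x \<in> aligned l \<Longrightarrow> entry x (p, q, m, n) \<noteq> 0 \<Longrightarrow> l \<le> n"
  by (cases "Poly_Mapping.lookup x (lab p, lab q, m, n) = 0") (auto simp: aligned_def entry_def)

lemma aligned_expand:
  assumes x: "x \<in> aligned l"
  shows "x = (\<Sum>z | entry x z \<noteq> 0. RA_scale (entry x z) (basis_elt z))"
proof (rule entry_inject[OF x])
  show "(\<Sum>z | entry x z \<noteq> 0. RA_scale (entry x z) (basis_elt z)) \<in> aligned l"
    by (intro RA.subspace_sum[OF subspace_aligned] RA.subspace_scale[OF subspace_aligned])
      (auto simp: basis_elt_def intro!: unit_elt_aligned dest: entry_nonzero[OF x])
  fix z
  show "entry x z = entry (\<Sum>z | entry x z \<noteq> 0. RA_scale (entry x z) (basis_elt z)) z"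
    by (simp add: entry_sum_scale entry_basis_elt finite_entry if_distrib cong: if_cong)
qed

lemma aligned_expand_mode:
  assumes "x \<in> aligned l"
  shows "mode RA_Y N u x = (\<Sum>z | entry x z \<noteq> 0. RA_scale (entry x z) (mode RA_Y N u (basis_elt z)))"
  by (subst aligned_expand[OF assms]) (simp only: mode_sum_scale)

text \<open>In this mode E_iq with exponents (m, n) acquires first exponent a+m-D, which falls below
  a and gives binomial 0 unless m = D. The other half would have second exponent at most a+n+1, and
  this is less than r.\<close>

lemma row_mode:
  fixes x :: "('a::field_char_0, 'm::finite, 'n::finite) RA"
  assumes x: "x \<in> aligned l" and D: "\<And>q m n. entry x (i, q, m, n) \<noteq> 0 \<Longrightarrow> m \<le> D"
    and r: "\<And>p q m n. entry x (p, q, m, n) \<noteq> 0 \<Longrightarrow> n + a + 2 \<le> r"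
  shows "mode RA_Y (r + D + wt i) (unit_elt k i a r) x
    = (\<Sum>(p, q, m, n) | entry x (p, q, m, n) \<noteq> 0 \<and> p = i \<and> m = D.
        RA_scale (entry x (p, q, m, n) * half_coeff (wt i) D r) (unit_elt k q a n))"
proof -
  have w: "wt p \<le> 1" for p :: "'m + 'n"
    by (simp add: kdelta_def)
  have m: "RA_scale (entry x z) (mode RA_Y (r + D + wt i) (unit_elt k i a r) (basis_elt z))
    = (case z of (p, q, m, n) \<Rightarrow> if p = i \<and> m = D
        then RA_scale (entry x (p, q, m, n) * half_coeff (wt i) D r) (unit_elt k q a n) else 0)"
    if "entry x z \<noteq> 0" for z
  proof -
    obtain p q m n where z: "z = (p, q, m, n)" by (cases z) auto
    have n: "n + a + 2 \<le> r" and mD: "p = i \<Longrightarrow> m \<le> D"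
      using r D that by (auto simp: z)
    have 1: "a + r + n + wt k - (r + D + wt i) < r"
      using n w[of k] by linarith
    have 2: "(if i = p \<and> r + D + wt i \<le> a + r + m + wt i
        then RA_scale (half_coeff (wt i) m r * of_nat ((a + r + m + wt i - (r + D + wt i)) choose a))
          (unit_elt k q (a + r + m + wt i - (r + D + wt i)) n) else 0)
      = (if p = i \<and> m = D then RA_scale (half_coeff (wt i) D r) (unit_elt k q a n) else 0 :: ('a, 'm, 'n) RA)"
    proof (cases "p = i \<and> m < D")
      case True
      hence "a + r + m + wt i - (r + D + wt i) < a \<or> \<not> r + D + wt i \<le> a + r + m + wt i"
        by linarith
      with True show ?thesis
        by (auto simp: binomial_eq_0)
    next
      case False
      with mD have "p \<noteq> i \<or> m = D" by linarith
      thus ?thesis by auto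
    qed
    show ?thesis
      unfolding z basis_elt_def prod.case mode_unit_elt Let_def 2 using 1
      by (simp add: binomial_eq_0)
  qed
  have "mode RA_Y (r + D + wt i) (unit_elt k i a r) x
    = (\<Sum>z | entry x z \<noteq> 0. case z of (p, q, m, n) \<Rightarrow> if p = i \<and> m = D
        then RA_scale (entry x (p, q, m, n) * half_coeff (wt i) D r) (unit_elt k q a n) else 0)"
    unfolding aligned_expand_mode[OF x] by (intro sum.cong refl) (use m in auto)
  also have "\<dots> = (\<Sum>(p, q, m, n) | entry x (p, q, m, n) \<noteq> 0 \<and> p = i \<and> m = D.
        RA_scale (entry x (p, q, m, n) * half_coeff (wt i) D r) (unit_elt k q a n))"
    by (rule sum.mono_neutral_cong_right) (auto simp: finite_entry split: if_splits)
  finally show ?thesis .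
qed

text \<open>Mirrored, the second exponent becomes r+n-E, which falls below r unless n = E, while the
  first half has first exponent at most r+a+1 < e. The summands share row k and exponent a, so only
  column q and n = E select one.\<close>

lemma column_mode:
  fixes f :: "('m::finite, 'n::finite) index \<Rightarrow> 'a::field_char_0"
  assumes S: "finite S" and z0: "(i, q, D, E) \<in> S"
    and iD: "\<And>p r m n. (p, r, m, n) \<in> S \<Longrightarrow> p = i \<and> m = D"
    and E: "\<And>n. (i, q, D, n) \<in> S \<Longrightarrow> n \<le> E" and e: "r + a + 2 \<le> e"
  shows "\<exists>c. c \<noteq> 0 \<and> mode RA_Y (e + E + wt q) (unit_elt q j e r)
      (\<Sum>(p, q, m, n)\<in>S. RA_scale (f (p, q, m, n)) (unit_elt k q a n)) = RA_scale (f (i, q, D, E) * c) (unit_elt k j a r)"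
proof -
  define c where "c = - (koszul_sign (lab q + lab j) (lab k + lab q) * (- 1) ^ wt q * half_coeff (wt q) E e :: 'a)"
  have w: "wt p \<le> 1" for p :: "'m + 'n"
    by (simp add: kdelta_def)
  have m: "mode RA_Y (e + E + wt q) (unit_elt q j e r) (unit_elt k q' a n)
    = (if q' = q \<and> n = E then RA_scale c (unit_elt k j a r) else 0)"
    if "q' = q \<Longrightarrow> n \<le> E" for q' n
  proof -
    have "e + r + a + wt j - (e + E + wt q) < e"
      using e w[of j] by linarith
    hence 1: "(e + r + a + wt j - (e + E + wt q)) choose e = 0"
      by (rule binomial_eq_0)
    have 2: "e + r + E + wt q - (e + E + wt q) = r" "e + E + wt q \<le> e + r + E + wt q"
      by simp_all
    show ?thesis
    proof (cases "q' = q")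
      case True
      show ?thesis
      proof (cases "n = E")
        case n: True
        show ?thesis
          unfolding True n mode_unit_elt Let_def 1 2 c_def by (simp add: 2)
      next
        case False
        with that True have "n < E" by simp
        hence "e + r + n + wt q - (e + E + wt q) < r \<or> \<not> e + E + wt q \<le> e + r + n + wt q"
          by linarith
        hence "(e + r + n + wt q - (e + E + wt q)) choose r = 0 \<or> \<not> e + E + wt q \<le> e + r + n + wt q"
          using binomial_eq_0 by blast
        thus ?thesis
          unfolding mode_unit_elt Let_def 1 using False by (elim disjE) simp_all
      qed
    next
      case False
      thus ?thesis
        unfolding mode_unit_elt Let_def 1 by simp
    qed
  qed
  have "mode RA_Y (e + E + wt q) (unit_elt q j e r)
      (\<Sum>(p, q, m, n)\<in>S. RA_scale (f (p, q, m, n)) (unit_elt k q a n))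
    = (\<Sum>z\<in>S. if z = (i, q, D, E) then RA_scale (f z) (RA_scale c (unit_elt k j a r)) else 0)"
    unfolding additive.sum[OF additive_mode_right]
  proof (intro sum.cong refl)
    fix z assume z: "z \<in> S"
    obtain p q' m n where z': "z = (p, q', m, n)" by (cases z) auto
    have "p = i" "m = D" "q' = q \<Longrightarrow> n \<le> E"
      using iD E z by (auto simp: z')
    thus "mode RA_Y (e + E + wt q) (unit_elt q j e r) (case z of (p, q, m, n) \<Rightarrow> RA_scale (f (p, q, m, n)) (unit_elt k q a n))
      = (if z = (i, q, D, E) then RA_scale (f z) (RA_scale c (unit_elt k j a r)) else 0)"
      by (simp add: z' mode_scale m)
  qed
  also have "\<dots> = RA_scale (f (i, q, D, E) * c) (unit_elt k j a r)"
    using S z0 by simp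
  finally have "mode RA_Y (e + E + wt q) (unit_elt q j e r)
      (\<Sum>(p, q, m, n)\<in>S. RA_scale (f (p, q, m, n)) (unit_elt k q a n)) = \<dots>" .
  moreover have "c \<noteq> 0"
    by (simp add: c_def half_coeff_nonzero koszul_sign_def)
  ultimately show ?thesis by blast
qed

text \<open>D and E are successive leading exponents: D the largest first exponent in a nonzero row
  i, E the largest second exponent in some column q among the terms with first exponent D. Hence
  exactly one term of x survives both actions.\<close>

lemma ideal_eq_aligned:
  fixes I :: "('a::field_char_0, 'm::finite, 'n::finite) RA set"
  assumes I: "RA.subspace I" "I \<subseteq> aligned l" and x: "x \<in> I" "x \<noteq> 0"
    and closed: "\<And>u v n. u \<in> aligned l \<Longrightarrow> v \<in> I \<Longrightarrow> mode RA_Y n u v \<in> I"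
  shows "I = aligned l"
proof -
  have xl: "x \<in> aligned l" using I x by blast
  have "\<exists>z. entry x z \<noteq> 0"
  proof (rule ccontr)
    assume "\<not> ?thesis"
    hence "{z. entry x z \<noteq> 0} = {}" by auto
    hence "x = 0" by (subst aligned_expand[OF xl]) (simp only: sum.empty)
    with x show False by simp
  qed
  then obtain i q1 m1 n1 where z1: "entry x (i, q1, m1, n1) \<noteq> 0" by auto
  define D where "D = Max ((\<lambda>(p, q, m, n). m) ` {z. entry x z \<noteq> 0 \<and> fst z = i})"
  have fin: "finite {z. entry x z \<noteq> 0 \<and> fst z = i}"
    by (rule finite_subset[OF _ finite_entry[of x]]) auto
  have D: "m \<le> D" if "entry x (i, q, m, n) \<noteq> 0" for q m n
    unfolding D_def by (rule Max_ge) (use fin that in force)+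
  have "D \<in> (\<lambda>(p, q, m, n). m) ` {z. entry x z \<noteq> 0 \<and> fst z = i}"
    unfolding D_def by (rule Max_in) (use fin z1 in auto)
  then obtain q n0 where z0: "entry x (i, q, D, n0) \<noteq> 0" by force
  define S where "S = {(p, q, m, n). entry x (p, q, m, n) \<noteq> 0 \<and> p = i \<and> m = D}"
  have finS: "finite S"
    by (rule finite_subset[OF _ finite_entry[of x]]) (auto simp: S_def)
  define E where "E = Max ((\<lambda>(p, q, m, n). n) ` {z \<in> S. fst (snd z) = q})"
  have E: "n \<le> E" if "(i, q, D, n) \<in> S" for n
    unfolding E_def by (rule Max_ge) (use finS that in force)+
  have "E \<in> (\<lambda>(p, q, m, n). n) ` {z \<in> S. fst (snd z) = q}"
    unfolding E_def by (rule Max_in) (use finS z0 in \<open>auto simp: S_def\<close>)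
  hence zE: "(i, q, D, E) \<in> S" by (force simp: S_def)
  define B where "B = Max ((\<lambda>(p, q, m, n). n) ` {z. entry x z \<noteq> 0})"
  have B: "n \<le> B" if "entry x (p, q, m, n) \<noteq> 0" for p q m n
    unfolding B_def by (rule Max_ge) (use finite_entry[of x] that in force)+
  have "unit_elt k j a s \<in> I" if s: "l \<le> s" for k j a s
  proof -
    \<comment> \<open>The summand l keeps the acting element in the algebra; B + a + 2 meets the
      bound of \<open>row_mode\<close> for every term of x.\<close>
    define r where "r = l + B + a + 2"
    have r: "n + a + 2 \<le> r" if "entry x (p, q, m, n) \<noteq> 0" for p q m n
      using B[OF that] by (simp add: r_def)
    define y where "y = mode RA_Y (r + D + wt i) (unit_elt k i a r) x"
    have "y \<in> I"
      unfolding y_def by (intro closed unit_elt_aligned x) (simp add: r_def)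
    define e where "e = s + a + 2"
    define f where "f z = entry x z * half_coeff (wt i) D r" for z
    have "y = (\<Sum>(p, q, m, n)\<in>S. RA_scale (f (p, q, m, n)) (unit_elt k q a n))"
      unfolding y_def S_def f_def by (rule row_mode[OF xl D r])
    moreover have "\<exists>c. c \<noteq> 0 \<and> mode RA_Y (e + E + wt q) (unit_elt q j e s)
      (\<Sum>(p, q, m, n)\<in>S. RA_scale (f (p, q, m, n)) (unit_elt k q a n)) = RA_scale (f (i, q, D, E) * c) (unit_elt k j a s)"
      by (rule column_mode[OF finS zE _ E]) (auto simp: S_def e_def)
    moreover have "mode RA_Y (e + E + wt q) (unit_elt q j e s) y \<in> I"
      by (rule closed[OF unit_elt_aligned[OF s] \<open>y \<in> I\<close>])
    ultimately obtain c where c: "c \<noteq> 0" "RA_scale (f (i, q, D, E) * c) (unit_elt k j a s) \<in> I"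
      by auto
    have "f (i, q, D, E) \<noteq> 0"
      using zE by (simp add: f_def S_def half_coeff_nonzero)
    with c(1) have "f (i, q, D, E) * c \<noteq> 0"
      by simp
    with subspace_cancel_scale[OF I(1) c(2)] show ?thesis .
  qed
  hence "aligned l \<subseteq> I"
    unfolding aligned_eq_span by (intro RA.span_minimal I) auto
  with I show ?thesis by blast
qed

subsection \<open>Generation\<close>

context conformal_superalgebra
begin

lemma subspace_whole: "subspace (whole R)"
proof -
  have "whole R = {x + y | x y. x \<in> R 0 \<and> y \<in> R 1}"
    by (auto simp: whole_def)
  thus ?thesis
    using subspace_sums[OF subspace_R[of 0] subspace_R[of 1]] by simp
qed

lemma R_subset_whole: "x \<in> R i \<Longrightarrow> x \<in> whole R"
  using subspace_0[OF subspace_R[of 0]] subspace_0[OF subspace_R[of 1]]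
  by (cases i) (force simp: whole_def)+

lemma mode_in_R: "u \<in> R i \<Longrightarrow> v \<in> R j \<Longrightarrow> mode Y n u v \<in> R (i + j)"
  unfolding mode_def by (rule Y_closed)

text \<open>This and the version for the other argument extend closure from monomials to their span
  by \<open>span_minimal\<close>.\<close>

lemma subspace_mode_left:
  assumes "subspace G" "w \<in> whole R"
  shows "subspace {u \<in> whole R. mode Y n u w \<in> G}"
proof -
  have "mode Y n 0 w = 0"
    using Y_scale_left[OF _ assms(2), of 0 0] subspace_0[OF subspace_whole] by (simp add: mode_def)
  thus ?thesis
    unfolding subspace_def
    using assms(2) subspace_0[OF assms(1)] subspace_0[OF subspace_whole] subspace_add[OF assms(1)]
      subspace_add[OF subspace_whole] subspace_scale[OF assms(1)] subspace_scale[OF subspace_whole]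
    by (simp add: mode_def Y_add_left Y_scale_left lookup_add)
qed

lemma subspace_mode_right:
  assumes "subspace G" "u \<in> whole R"
  shows "subspace {w \<in> whole R. mode Y n u w \<in> G}"
proof -
  have "mode Y n u 0 = 0"
    using Y_scale_right[OF assms(2), of 0 0] subspace_0[OF subspace_whole] by (simp add: mode_def)
  thus ?thesis
    unfolding subspace_def
    using assms(2) subspace_0[OF assms(1)] subspace_0[OF subspace_whole] subspace_add[OF assms(1)]
      subspace_add[OF subspace_whole] subspace_scale[OF assms(1)] subspace_scale[OF subspace_whole]
    by (simp add: mode_def Y_add_right Y_scale_right lookup_add)
qed

lemma monomials_homogeneous:
  assumes S: "\<And>x. x \<in> S \<Longrightarrow> \<exists>i. x \<in> R i" and "x \<in> monomials S"
  shows "\<exists>i. x \<in> R i"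
  using assms(2) by induction (use S mode_in_R in blast)+

lemma span_monomials_subset:
  assumes S: "\<And>x. x \<in> S \<Longrightarrow> \<exists>i. x \<in> R i"
  shows "span (monomials S) \<subseteq> whole R"
  using monomials_homogeneous[OF S] R_subset_whole
  by (intro span_minimal subspace_whole) blast

text \<open>
  The modes of \<open>u\<^sub>r v\<close> are obtained from iterated modes of \<open>u\<close> and \<open>v\<close> by solving the commutator
  formula, which is triangular in \<open>r\<close>.
\<close>

lemma span_monomials_mode_closed:
  assumes S: "\<And>x. x \<in> S \<Longrightarrow> \<exists>i. x \<in> R i"
    and a: "a \<in> span (monomials S)" and w: "w \<in> span (monomials S)"
  shows "mode Y n a w \<in> span (monomials S)"
proof -
  let ?G = "span (monomials S)"
  have whole: "x \<in> whole R" if "x \<in> ?G" for x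
    using span_monomials_subset[of S] S that by blast
  have S_mode: "mode Y n u w \<in> ?G" if "u \<in> S" "w \<in> ?G" for u w n
  proof -
    have "u \<in> whole R" using S that(1) R_subset_whole by blast
    hence "?G \<subseteq> {w \<in> whole R. mode Y n u w \<in> ?G}"
      by (intro span_minimal subspace_mode_right subspace_span)
        (auto intro: whole span_base monomials.app[OF that(1)])
    with that(2) show ?thesis by blast
  qed
  have mon: "\<forall>n. \<forall>w\<in>?G. mode Y n a w \<in> ?G" if "a \<in> monomials S" for a
    using that
  proof induction
    case (gen v)
    thus ?case using S_mode by blast
  next
    case (app u v m)
    obtain i where i: "u \<in> R i" using S app.hyps by blast
    obtain j where j: "v \<in> R j" using monomials_homogeneous[OF S app.hyps(2)] by blast
    have "\<forall>n. \<forall>w\<in>?G. mode Y n (mode Y m u v) w \<in> ?G"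
    proof (induction m rule: less_induct)
      case (less m)
      show ?case
      proof (intro allI ballI)
        fix n w assume w: "w \<in> ?G"
        let ?t = "\<lambda>r. scale (of_nat (m choose r)) (mode Y (m + n - r) (mode Y r u v) w)"
        have "mode Y m u (mode Y n v w) \<in> ?G" "mode Y n v (mode Y m u w) \<in> ?G"
          using S_mode[OF app.hyps(1)] app.IH w by blast+
        hence "(\<Sum>r\<le>m. ?t r) \<in> ?G"
          unfolding commutator[OF i j whole[OF w], symmetric] by (intro span_diff span_scale)
        moreover have "(\<Sum>r<m. ?t r) \<in> ?G"
          by (intro span_sum span_scale) (use less w in auto)
        \<comment> \<open>The top term r = m has coefficient 1 and outer mode m + n - m = n.\<close>
        moreover have "(\<Sum>r\<le>m. ?t r) = (\<Sum>r<m. ?t r) + mode Y n (mode Y m u v) w"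
          by (simp add: lessThan_Suc_atMost[symmetric])
        ultimately show "mode Y n (mode Y m u v) w \<in> ?G"
          using span_diff by fastforce
      qed
    qed
    thus ?case .
  qed
  have "?G \<subseteq> {u \<in> whole R. mode Y n u w \<in> ?G}"
    by (intro span_minimal subspace_mode_left subspace_span)
      (auto intro: whole span_base w mon[rule_format])
  with a show ?thesis by blast
qed

lemma monomials_mono: "S \<subseteq> T \<Longrightarrow> x \<in> monomials S \<Longrightarrow> x \<in> monomials T"
  by (rotate_tac 1, induction rule: monomials.induct) (auto intro: monomials.intros)

end

section \<open>Generation, simplicity and the weight space of the subalgebra\<close>

lemma mode_aligned:
  assumes "u \<in> aligned l" "w \<in> aligned l"
  shows "mode RA_Y n u w \<in> aligned l"
proof -
  obtain u0 u1 where u: "u0 \<in> homog l 0" "u1 \<in> homog l 1" "u = u0 + u1"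
    using assms(1) unfolding whole_homog[symmetric] by (rule whole_homogE)
  obtain w0 w1 where w: "w0 \<in> homog l 0" "w1 \<in> homog l 1" "w = w0 + w1"
    using assms(2) unfolding whole_homog[symmetric] by (rule whole_homogE)
  have "mode RA_Y n x y \<in> aligned l" if "x \<in> homog l i" "y \<in> homog l j" for x y i j
    using mode_closed[OF that] homog_subset_aligned by blast
  note modes = this[OF u(1) w(1)] this[OF u(1) w(2)] this[OF u(2) w(1)] this[OF u(2) w(2)]
  show ?thesis
    unfolding u(3) w(3) additive.add[OF additive_mode_left] additive.add[OF additive_mode_right]
    by (intro RA.subspace_add[OF subspace_aligned] modes)
qed

lemma unit_elt_homogeneous: "l \<le> n \<Longrightarrow> \<exists>i. unit_elt p q m n \<in> homog l i"
  by (blast intro: unit_elt_in_homog)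

text \<open>S consists of homogeneous elements, as closure under modes requires, while T is the
  generating set of the claim: for k > 2 the whole weight space, with S the matrix units spanning
  it; for k = 2 both sets agree.\<close>

lemma generated_by_homog:
  fixes S T :: "('a::field_char_0, 'm::finite, 'n::finite) RA set"
  assumes S: "S \<subseteq> T" "T \<subseteq> aligned l" "\<And>x. x \<in> S \<Longrightarrow> \<exists>i. x \<in> homog l i"
    and ij: "\<And>a b. unit_elt (Inl a) (Inr b) 0 l \<in> S" and ji: "\<And>a b. unit_elt (Inr b) (Inl a) 0 l \<in> S"
    and jj: "CARD('m) + CARD('n) > 2 \<or> (\<forall>b. unit_elt (Inr b) (Inr b) 0 (l + 1) \<in> S)"
  shows "conformal_superalgebra.generated_by RA_scale (homog l) RA_Y T"
proof -
  interpret C: conformal_superalgebra RA_scale "homog l :: bit \<Rightarrow> ('a, 'm, 'n) RA set" RA_deriv RA_Y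
    by (rule conformal_superalgebra_homog)
  interpret G: mode_closed_subspace "RA.span (C.monomials S)"
    by standard (use C.span_monomials_mode_closed[OF S(3)] in auto)
  have base: "x \<in> RA.span (C.monomials S)" if "x \<in> S" for x
    using that by (intro RA.span_base C.monomials.gen)
  note ij' = base[OF ij] and ji' = base[OF ji]
  have "unit_elt (Inr b) (Inr b) 0 (l + 1) \<in> RA.span (C.monomials S)" for b
    using jj G.third_generator[OF ij' ji'] base by blast
  hence "aligned l \<subseteq> RA.span (C.monomials S)"
    by (rule G.generation[OF ij' ji'])
  also have "\<dots> \<subseteq> RA.span (C.monomials T)"
    using C.monomials_mono[OF S(1)] by (intro RA.span_mono) blast
  finally have "aligned l \<subseteq> RA.span (C.monomials T)" .
  moreover have "x \<in> aligned l" if "x \<in> C.monomials T" for x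
    using that
  proof induction
    case (app u w m)
    thus ?case using S(2) by (blast intro: mode_aligned)
  qed (use S(2) in blast)
  ultimately show ?thesis
    unfolding C.generated_by_def whole_homog
    using S(2) by (intro conjI equalityI RA.span_minimal subspace_aligned) auto
qed

lemma simple_homog:
  "conformal_superalgebra.simple RA_scale
     (homog l :: bit \<Rightarrow> ('a::field_char_0, 'm::finite, 'n::finite) RA set) RA_deriv RA_Y"
proof -
  interpret C: conformal_superalgebra RA_scale "homog l :: bit \<Rightarrow> ('a, 'm, 'n) RA set" RA_deriv RA_Y
    by (rule conformal_superalgebra_homog)
  show ?thesis
    unfolding C.simple_def C.ideal_def whole_homog
  proof (intro allI impI)
    fix I :: "('a, 'm, 'n) RA set"
    assume I: "RA.subspace I \<and> I \<subseteq> aligned l \<and> RA_deriv ` I \<subseteq> I \<and>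
      (\<forall>u\<in>aligned l. \<forall>v\<in>I. \<forall>e. Poly_Mapping.lookup (RA_Y u v) e \<in> I)"
    show "I = {0} \<or> I = aligned l"
    proof (cases "I = {0}")
      case False
      with I obtain x where "x \<in> I" "x \<noteq> 0"
        using RA.subspace_0 by blast
      with I have "I = aligned l"
        by (intro ideal_eq_aligned[where x = x]) (auto simp: mode_def)
      thus ?thesis ..
    qed simp
  qed
qed

text \<open>Diagonal blocks have integral weights, so the half-integral weight forces an
  off-diagonal unit, of weight m+n+3/2; with n >= l this leaves m = 0 and n = l.\<close>

lemma weight_space_aligned:
  "weight_space (aligned l) (of_nat l + 3 / 2) =
    RA.span ({unit_elt (Inl p) (Inr q) 0 l | p q. True} \<union> {unit_elt (Inr q) (Inl p) 0 l | p q. True}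
      :: ('a::field_char_0, 'm::finite, 'n::finite) RA set)" (is "_ = RA.span ?B")
proof
  have "RA.subspace (weight_space (aligned l) w :: ('a, 'm, 'n) RA set)" for w
  proof -
    have "weight_space (aligned l) w = {x :: ('a, 'm, 'n) RA. x \<in> aligned l \<and>
        (\<forall>a. Poly_Mapping.lookup x a \<noteq> 0 \<longrightarrow> weight a = w)}"
      by (auto simp: weight_space_def in_keys_iff)
    moreover have "RA.subspace \<dots>"
      unfolding RA.subspace_def mem_Collect_eq
    proof (intro conjI ballI allI impI; (elim CollectE conjE)?)
      fix x y :: "('a, 'm, 'n) RA" and c and a :: "bit \<times> bit \<times> nat \<times> nat"
      assume x: "x \<in> aligned l" "\<forall>a. Poly_Mapping.lookup x a \<noteq> 0 \<longrightarrow> weight a = w"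
      show "RA_scale c x \<in> aligned l"
        using x(1) by (rule RA.subspace_scale[OF subspace_aligned])
      show "weight a = w" if "Poly_Mapping.lookup (RA_scale c x) a \<noteq> 0"
        using that x(2)[rule_format, of a] by (cases "Poly_Mapping.lookup x a = 0") (simp_all add: RA_scale_lookup)
      assume y: "y \<in> aligned l" "\<forall>a. Poly_Mapping.lookup y a \<noteq> 0 \<longrightarrow> weight a = w"
      show "x + y \<in> aligned l"
        using x(1) y(1) by (rule RA.subspace_add[OF subspace_aligned])
      show "weight a = w" if "Poly_Mapping.lookup (x + y) a \<noteq> 0"
        using that x(2)[rule_format, of a] y(2)[rule_format, of a]
        by (cases "Poly_Mapping.lookup x a = 0") (simp_all add: lookup_add)
    qed (auto simp: RA.subspace_0[OF subspace_aligned])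
    ultimately show ?thesis by simp
  qed
  moreover have mem: "unit_elt p q 0 l \<in> weight_space (aligned l) (weight (lab p, lab q, 0, l))" for p q :: "'m + 'n"
    by (simp add: weight_space_def unit_elt_aligned) (simp add: unit_elt_def elt_def)
  have "weight (0, 1, 0, l) = of_nat l + 3 / 2" "weight (1, 0, 0, l) = of_nat l + 3 / 2"
    by (simp_all add: weight_def field_simps)
  hence "unit_elt (Inl p) (Inr q) 0 l \<in> weight_space (aligned l) (of_nat l + 3 / 2)"
    "unit_elt (Inr q) (Inl p) 0 l \<in> weight_space (aligned l) (of_nat l + 3 / 2)" for p :: 'm and q :: 'n
    using mem[of "Inl p" "Inr q"] mem[of "Inr q" "Inl p"] by simp_all
  hence "?B \<subseteq> weight_space (aligned l) (of_nat l + 3 / 2)"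
    by blast
  ultimately show "RA.span ?B \<subseteq> weight_space (aligned l) (of_nat l + 3 / 2)"
    by (intro RA.span_minimal)
  show "weight_space (aligned l) (of_nat l + 3 / 2) \<subseteq> RA.span ?B"
  proof
    fix x :: "('a, 'm, 'n) RA"
    assume x: "x \<in> weight_space (aligned l) (of_nat l + 3 / 2)"
    hence xl: "x \<in> aligned l" by (simp add: weight_space_def)
    show "x \<in> RA.span ?B"
    proof (subst aligned_expand[OF xl], intro RA.span_sum RA.span_scale RA.span_base)
      fix z assume z: "z \<in> {z. entry x z \<noteq> 0}"
      obtain p q m n where z': "z = (p, q, m, n)" by (cases z) auto
      have n: "l \<le> n"
        using entry_nonzero[OF xl] z by (simp add: z')
      have "(lab p, lab q, m, n) \<in> Poly_Mapping.keys x"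
        using z by (auto simp: z' entry_def in_keys_iff)
      hence "weight (lab p, lab q, m, n) = of_nat l + 3 / 2"
        using x by (simp add: weight_space_def)
      \<comment> \<open>Doubling the weight moves the equation to the natural numbers, where parity
        and linear arithmetic decide it.\<close>
      hence "of_nat (2 * (m + n) + 2 * wt p + 2 * wt q + kdelta (lab p) 1 + kdelta (lab q) 1) = (of_nat (2 * l + 3) :: rat)"
        by (simp add: weight_def field_simps)
      hence w: "2 * (m + n) + 2 * wt p + 2 * wt q + kdelta (lab p) 1 + kdelta (lab q) 1 = 2 * l + 3"
        by (simp only: of_nat_eq_iff)
      show "basis_elt z \<in> ?B"
      proof (cases p)
        case p: (Inl a)
        show ?thesis
        proof (cases q)
          case q: (Inl a')
          from w show ?thesis by (simp add: p q) presburger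
        next
          case q: (Inr b)
          from w n have "m = 0" "n = l" by (simp_all add: p q)
          thus ?thesis by (auto simp: z' basis_elt_def p q)
        qed
      next
        case p: (Inr b)
        show ?thesis
        proof (cases q)
          case q: (Inr b')
          from w show ?thesis by (simp add: p q) presburger
        next
          case q: (Inl a)
          from w n have "m = 0" "n = l" by (simp_all add: p q)
          thus ?thesis by (auto simp: z' basis_elt_def p q)
        qed
      qed
    qed
  qed
qed

theorem theorem4p1:
  fixes l :: nat
    and R :: "bit \<Rightarrow> ('a::field_char_0, 'm::finite, 'n::finite) RA set"
  assumes R: "R = Rsub l"
  shows "conformal_superalgebra RA_scale R RA_deriv RA_Y \<and>
    conformal_superalgebra.simple RA_scale R RA_deriv RA_Y \<and>
    (CARD('m) + CARD('n) > 2 \<longrightarrow>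
      conformal_superalgebra.generated_by RA_scale R RA_Y
        (weight_space (whole R) (of_nat l + 3 / 2)) \<and>
      weight_space (whole R) (of_nat l + 3 / 2) =
        RA.span
          ({elt (matrix_unit (Inl p) (Inr q)) 0 1 0 l | p q. True} \<union>
           {elt (matrix_unit (Inr q) (Inl p)) 1 0 0 l | p q. True})) \<and>
    (CARD('m) + CARD('n) = 2 \<longrightarrow>
      (\<forall>(p :: 'm) (q :: 'n).
        conformal_superalgebra.generated_by RA_scale R RA_Y
          {elt (matrix_unit (Inl p) (Inr q)) 0 1 0 l,
           elt (matrix_unit (Inr q) (Inl p)) 1 0 0 l,
           elt (matrix_unit (Inr q) (Inr q)) 1 1 0 (l + 1)}))"
proof -
  have Rh: "R = homog l"
    using R by (simp add: Rsub_eq_homog)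
  let ?S = "{unit_elt (Inl p) (Inr q) 0 l | p q. True} \<union> {unit_elt (Inr q) (Inl p) 0 l | p q. True} :: ('a, 'm, 'n) RA set"
  have S: "?S = {elt (matrix_unit (Inl p) (Inr q)) 0 1 0 l | p q. True} \<union>
           {elt (matrix_unit (Inr q) (Inl p)) 1 0 0 l | p q. True}"
    by (simp add: unit_elt_def)
  have ws: "weight_space (whole R) (of_nat l + 3 / 2) = RA.span ?S"
    unfolding Rh whole_homog by (rule weight_space_aligned)
  have "conformal_superalgebra.generated_by RA_scale R RA_Y (weight_space (whole R) (of_nat l + 3 / 2))"
    if "CARD('m) + CARD('n) > 2"
    unfolding Rh
  proof (rule generated_by_homog[where S = ?S])
    show "?S \<subseteq> weight_space (whole (homog l)) (of_nat l + 3 / 2)"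
      using ws RA.span_superset[of ?S] by (simp only: Rh)
    show "\<exists>i. x \<in> homog l i" if "x \<in> ?S" for x
      using that by (auto intro: unit_elt_homogeneous)
  qed (use that in \<open>auto simp: weight_space_def whole_homog\<close>)
  moreover have "conformal_superalgebra.generated_by RA_scale R RA_Y
          {elt (matrix_unit (Inl p) (Inr q)) 0 1 0 l,
           elt (matrix_unit (Inr q) (Inl p)) 1 0 0 l,
           elt (matrix_unit (Inr q) (Inr q)) 1 1 0 (l + 1)}" (is "conformal_superalgebra.generated_by _ _ _ ?T")
    if card: "CARD('m) + CARD('n) = 2" for p :: 'm and q :: 'n
    unfolding Rh
  proof (rule generated_by_homog[where S = ?T])
    \<comment> \<open>Both index types are singletons, so p and q are the only indices and the three
      elements cover all units that \<open>generated_by_homog\<close> asks for.\<close>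
    have "CARD('m) > 0" "CARD('n) > 0" by simp_all
    with card have "CARD('m) = 1" "CARD('n) = 1" by linarith+
    hence p: "a = p" and q: "b = q" for a :: 'm and b :: 'n
      by (auto simp: card_1_singleton_iff) (metis UNIV_I singletonD)+
    have T: "?T = {unit_elt (Inl p) (Inr q) 0 l, unit_elt (Inr q) (Inl p) 0 l, unit_elt (Inr q) (Inr q) 0 (l + 1)}"
      by (simp add: unit_elt_def)
    show "?T \<subseteq> aligned l"
      unfolding T by (auto intro: unit_elt_aligned)
    show "\<exists>i. x \<in> homog l i" if "x \<in> ?T" for x
      using that unfolding T by (auto intro: unit_elt_homogeneous)
    show "unit_elt (Inl a) (Inr b) 0 l \<in> ?T" "unit_elt (Inr b) (Inl a) 0 l \<in> ?T" for a b
      unfolding T p[of a] q[of b] by simp_all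
    show "CARD('m) + CARD('n) > 2 \<or> (\<forall>b. unit_elt (Inr b) (Inr b) 0 (l + 1) \<in> ?T)"
    proof (intro disjI2 allI)
      show "unit_elt (Inr b) (Inr b) 0 (l + 1) \<in> ?T" for b
        unfolding T q[of b] by simp
    qed
  qed simp
  moreover have "conformal_superalgebra RA_scale R RA_deriv RA_Y"
    unfolding Rh by (rule conformal_superalgebra_homog)
  moreover have "conformal_superalgebra.simple RA_scale R RA_deriv RA_Y"
    unfolding Rh by (rule simple_homog)
  ultimately show ?thesis
    using ws unfolding S by blast
qed

end
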